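(* Let $a,b,f$ be as in the context. Assume that there are $\gamma\ge0$ and $\mathfrak{a}>0$ such that $a(x)=\mathfrak{a}x^\gamma$ for $x>0$, and set $\alpha:=(\gamma+2)/2$. For $m\in(1,\infty)$ let $$\delta_m:=\inf_{y>0}\left\{1-\frac1{y^m}\int_0^y x^m b(x,y)\,\mathrm{d}x\right\}.$$ Assume further that there are $\chi\ge0$ and $m_0\ge1$ such that $$1-\frac{\chi}{m}\le\delta_m\le1\qquad\text{for all } m\ge m_0 \text{ with } m>1.$$ Then, given $\mu>(\alpha+\chi-1)/2$, there is $\kappa_\mu>0$ such that $$f(1)x^{-\gamma/4}e^{-\sqrt{\mathfrak{a}}x^\alpha/\alpha}\le f(x)\le\kappa_\mu x^{1+\alpha+\mu}e^{-\sqrt{\mathfrak{a}}x^\alpha/\alpha},\qquad x\ge1.$$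
   Context: For $m\in\mathbb{R}$, $X_m:=L_1((0,\infty),x^m\mathrm{d}x)$. Standing assumptions: $a\in L_{\infty,loc}([0,\infty))$, $a>0$ a.e. in $(0,\infty)$, and $\liminf_{x\to\infty}a(x)\in(0,\infty]$; $b$ is a positive measurable function on $(0,\infty)^2$ (only its values for $0<x<y$ matter) with $\int_0^y xb(x,y)\,\mathrm{d}x=y$ for all $y\in(0,\infty)$ and $\delta_2:=\inf_{y>0}\{1-y^{-2}\int_0^y x^2b(x,y)\,\mathrm{d}x\}>0$. Under these assumptions it is known that there is a unique nonnegative $f\in C([0,\infty))\cap C^\infty((0,\infty))$ solving $-f''(x)+a(x)f(x)=\int_x^\infty a(y)b(x,y)f(y)\,\mathrm{d}y$ for $x\in(0,\infty)$, $f(0)=0$, with $f\in\bigcap_{m>-1}X_m$, $af\in\bigcap_{m>-1}X_m$, $f''\in\bigcap_{m\ge1}X_m$, and $\int_0^\infty xf(x)\,\mathrm{d}x=1$; moreover $\lim_{z\to\infty}f(z)=\lim_{z\to\infty}zf'(z)=0$. This function is denoted $f$ throughout. *)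

theory Defs
  imports "HOL-Analysis.Analysis"
begin

text \<open>The weighted space \<open>X\<^sub>m = L\<^sub>1((0,\<infinity>), x\<^sup>m dx)\<close>. Functions on the half-line are total functions on
  the reals whose values outside the half-line are never used; elements are functions, not
  classes modulo null sets.\<close>

definition X_space :: "real \<Rightarrow> (real \<Rightarrow> real) set" where
  "X_space m = {g. set_integrable lebesgue {0<..} (\<lambda>x. x powr m * g x)}"

definition Linf_loc :: "(real \<Rightarrow> real) \<Rightarrow> bool" where
  "Linf_loc a \<longleftrightarrow>
     a \<in> borel_measurable (lebesgue_on {0..}) \<and>
     (\<forall>R>0. \<exists>C. AE x in lebesgue. x \<in> {0..R} \<longrightarrow> \<bar>a x\<bar> \<le> C)"

text \<open>On an open set, being infinitely differentiable amounts to all iterated derivatives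
  being differentiable at every point.\<close>

definition smooth_pos :: "(real \<Rightarrow> real) \<Rightarrow> bool" where
  "smooth_pos f \<longleftrightarrow> (\<forall>n. \<forall>x>0. (deriv ^^ n) f field_differentiable (at x))"

text \<open>For \<open>m \<ge> 1\<close> and \<open>b\<close> as in \<open>frag_coeffs\<close> below, the real-valued infimum is harmless: the
  integrand is dominated by \<open>y powr (m - 1) * (x * b x y)\<close>, so all values lie in \<open>[0,1]\<close>.\<close>

definition delta :: "(real \<Rightarrow> real \<Rightarrow> real) \<Rightarrow> real \<Rightarrow> real" where
  "delta b m =
     (INF y\<in>{0<..}. 1 - 1 / y powr m * (LINT x:{0<..<y}|lebesgue. x powr m * b x y))"

text \<open>The standing assumptions on the overall fragmentation rate \<open>a\<close> and the daughter
  distribution \<open>b\<close>. Only the values \<open>b x y\<close> for \<open>0 < x < y\<close> matter, so nothing is required of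
  the others.\<close>

definition frag_coeffs :: "(real \<Rightarrow> real) \<Rightarrow> (real \<Rightarrow> real \<Rightarrow> real) \<Rightarrow> bool" where
  "frag_coeffs a b \<longleftrightarrow>
     Linf_loc a \<and>
     (AE x in lebesgue. 0 < x \<longrightarrow> 0 < a x) \<and>
     0 < Liminf at_top (\<lambda>x. ereal (a x)) \<and>
     (\<lambda>(x, y). b x y) \<in> borel_measurable (lebesgue_on {(x, y). 0 < x \<and> x < y}) \<and>
     (\<forall>x y. 0 < x \<and> x < y \<longrightarrow> 0 < b x y) \<and>
     (\<forall>y>0. set_integrable lebesgue {0<..<y} (\<lambda>x. x * b x y) \<and>
            (LINT x:{0<..<y}|lebesgue. x * b x y) = y) \<and>
     0 < delta b 2"

text \<open>The properties that characterise the stationary profile \<open>f\<close>. Integrability of the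
  right-hand side of the equation is stated explicitly because the integral of a
  non-integrable function is \<open>0\<close> by convention.\<close>

definition stationary_profile ::
    "(real \<Rightarrow> real) \<Rightarrow> (real \<Rightarrow> real \<Rightarrow> real) \<Rightarrow> (real \<Rightarrow> real) \<Rightarrow> bool" where
  "stationary_profile a b f \<longleftrightarrow>
     (\<forall>x\<ge>0. 0 \<le> f x) \<and>
     continuous_on {0..} f \<and>
     smooth_pos f \<and>
     (\<forall>x>0. set_integrable lebesgue {x<..} (\<lambda>y. a y * b x y * f y) \<and>
            - deriv (deriv f) x + a x * f x = (LINT y:{x<..}|lebesgue. a y * b x y * f y)) \<and>
     f 0 = 0 \<and>
     (\<forall>m>-1. f \<in> X_space m) \<and>
     (\<forall>m>-1. (\<lambda>x. a x * f x) \<in> X_space m) \<and>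
     (\<forall>m\<ge>1. deriv (deriv f) \<in> X_space m) \<and>
     (LINT x:{0<..}|lebesgue. x * f x) = 1"

end

theory Submission
  imports Defs "HOL-Real_Asymp.Real_Asymp"
begin

text \<open>
  Since \<open>- f'' + a f\<close> is nonnegative, \<open>f\<close> is a supersolution of \<open>w'' = a w\<close>, while the WKB function
  \<open>x\<^sup>-\<^sup>\<gamma>\<^sup>/\<^sup>4 exp (- \<surd>\<aa> x\<^sup>\<alpha> / \<alpha>)\<close> is a subsolution; the minimum principle gives the lower bound.
  For the upper bound, integrate the equation against \<open>x\<^sup>m\<close>: with \<open>\<delta>\<^sub>m \<ge> 1 - \<chi>/m\<close>, the moments satisfy
  \<open>\<aa> (1 - \<chi>/m) M(m + \<gamma>) \<le> m (m - 1) M(m - 2)\<close>. Raabe's test then shows that the moments along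
  steps of length \<open>2\<alpha> = \<gamma> + 2\<close> are summable against the Taylor coefficients of \<open>cosh\<close>, damped by a power of
  the index, that is, that \<open>x\<^sup>-\<^sup>p exp (\<surd>\<aa> x\<^sup>\<alpha> / \<alpha>) f(x)\<close> is integrable at infinity for \<open>p = \<mu> + 2 - \<alpha>\<close>.
  Finally \<open>f(x) = \<integral> (y - x) f''(y) dy \<le> \<integral> y a(y) f(y) dy\<close>, both over \<open>y > x\<close>, turns this into a
  pointwise bound.
\<close>

section \<open>The lower bound\<close>

text \<open>A negative value, together with \<open>start\<close> and \<open>tail\<close>, forces a
  negative minimum in the interior of a compact interval. There \<open>h1\<close> vanishes, and
  \<open>neg\<close> makes it negative just to the right, so \<open>h\<close> would drop below its
  minimum. The condition \<open>tail\<close> is one on the lower limit, which suits the difference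
  of a nonnegative function and one that tends to 0.\<close>

lemma min_principle_half_line:
  fixes h h1 h2 :: "real \<Rightarrow> real"
  assumes cont: "continuous_on {c..} h"
    and d1: "\<And>x. c < x \<Longrightarrow> (h has_real_derivative h1 x) (at x)"
    and d2: "\<And>x. c < x \<Longrightarrow> (h1 has_real_derivative h2 x) (at x)"
    and start: "0 \<le> h c"
    and tail: "\<And>\<epsilon>. 0 < \<epsilon> \<Longrightarrow> eventually (\<lambda>x. - \<epsilon> < h x) at_top"
    and neg: "\<And>x. c < x \<Longrightarrow> h x < 0 \<Longrightarrow> h2 x < 0"
    and x: "c \<le> x"
  shows "0 \<le> h x"
proof (rule ccontr)
  assume "\<not> 0 \<le> h x"
  then have hx: "h x < 0" by simp
  then have "c < x" using start x by (cases "x = c") auto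
  \<comment> \<open>The value at the right end \<open>R\<close> exceeds \<open>h x\<close>, so the
    minimum over [c, R] is not attained at \<open>R\<close>.\<close>
  have "eventually (\<lambda>y. h x < h y \<and> x < y) at_top"
    using tail[of "- h x"] eventually_gt_at_top[of x] hx by (simp add: eventually_conj_iff)
  then obtain R where R: "h x < h R" "x < R" by (auto simp: eventually_at_top_linorder)
  have "continuous_on {c..R} h" using cont by (rule continuous_on_subset) auto
  then obtain z where z: "z \<in> {c..R}" "\<And>y. y \<in> {c..R} \<Longrightarrow> h z \<le> h y"
    using continuous_attains_inf[of "{c..R}" h] \<open>c < x\<close> \<open>x < R\<close> by auto
  have hz: "h z \<le> h x" using z(2) \<open>c < x\<close> \<open>x < R\<close> by auto
  then have zc: "c < z" "z < R" using z(1) start hx R by (auto simp: order_le_less)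
  have "h1 z = 0"
  proof (rule DERIV_local_min[OF d1[OF zc(1)]])
    show "0 < min (z - c) (R - z)" using zc by simp
    show "\<forall>y. \<bar>z - y\<bar> < min (z - c) (R - z) \<longrightarrow> h z \<le> h y"
      by (intro allI impI z(2)) (simp; linarith)
  qed
  have "h2 z < 0" using neg zc hz hx by auto
  from DERIV_neg_dec_right[OF d2[OF zc(1)] this]
  obtain d where d: "0 < d" "\<And>e. 0 < e \<Longrightarrow> e < d \<Longrightarrow> h1 (z + e) < h1 z" by auto
  define e where "e = min (d / 2) ((R - z) / 2)"
  have e: "0 < e" "e < d" "z + e < R" using d(1) zc by (auto simp: e_def min_def field_simps)
  have "h (z + e) < h z"
  proof (rule DERIV_neg_imp_decreasing_open[where f = h])
    show "z < z + e" using e by simp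
    show "\<exists>y. DERIV h u :> y \<and> y < 0" if "z < u" "u < z + e" for u
      using d1[of u] d(2)[of "u - z"] that zc e \<open>h1 z = 0\<close> by auto
    show "continuous_on {z..z + e} h" using cont by (rule continuous_on_subset) (use zc in auto)
  qed
  moreover have "h z \<le> h (z + e)" using z(2) e zc by auto
  ultimately show False by simp
qed

text \<open>\<open>v\<close> is the logarithmic derivative of \<open>W\<close>, hence W'' = (v' +
  v^2) W. For \<gamma> \<ge> 0 the remainder of order 1/x^2 is nonnegative, so \<open>W\<close> is a
  subsolution of w'' = c^2 x^\<gamma> w.\<close>

lemma WKB_second_derivative:
  fixes c \<gamma> \<alpha> :: real
  assumes \<alpha>: "\<alpha> = (\<gamma> + 2) / 2" "0 < \<alpha>" and x: "0 < x"
  defines "W \<equiv> \<lambda>x. x powr (- \<gamma> / 4) * exp (- c * x powr \<alpha> / \<alpha>)"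
    and "v \<equiv> \<lambda>x. - \<gamma> / (4 * x) - c * x powr (\<gamma> / 2)"
  shows "(W has_real_derivative v x * W x) (at x)"
    and "((\<lambda>x. v x * W x) has_real_derivative
            (c\<^sup>2 * x powr \<gamma> + \<gamma> / 4 * (\<gamma> / 4 + 1) / x\<^sup>2) * W x) (at x)"
proof -
  have e1: "y powr (- \<gamma> / 4 - 1) = y powr (- \<gamma> / 4) / y" "y powr (\<gamma> / 2 - 1) = y powr (\<gamma> / 2) / y"
    if "0 < y" for y :: real
    using that by (simp_all add: powr_diff)
  have e3: "x powr ((- \<gamma> - 4) / 4) = x powr (- (\<gamma> / 4)) / x"
    using e1(1)[OF x] by (simp add: field_simps)
  have e4: "x powr ((\<gamma> - 2) / 2) = x powr (\<gamma> / 2) / x"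
    using e1(2)[OF x] by (simp add: field_simps)
  have e2: "\<alpha> - 1 = \<gamma> / 2" using \<alpha> by simp
  show W: "(W has_real_derivative v x * W x) (at x)"
    unfolding W_def v_def using x \<alpha>(2)
    by (auto intro!: derivative_eq_intros simp: e1[OF x] e2 e3 field_simps)
  have "(v has_real_derivative \<gamma> / (4 * x\<^sup>2) - c * (\<gamma> / 2) * x powr (\<gamma> / 2) / x) (at x)"
    unfolding v_def using x
    by (auto intro!: derivative_eq_intros simp: e1[OF x] e4 field_simps power2_eq_square)
  from DERIV_mult[OF this W]
  have "((\<lambda>x. v x * W x) has_real_derivative
      (\<gamma> / (4 * x\<^sup>2) - c * (\<gamma> / 2) * x powr (\<gamma> / 2) / x + (v x)\<^sup>2) * W x) (at x)"
    by (rule DERIV_cong) (simp add: algebra_simps power2_eq_square)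
  \<comment> \<open>The mixed term of the square of \<open>v x\<close> cancels the derivative of
    \<open>- c * x powr (\<gamma> / 2)\<close>; the exponent -\<gamma>/4 in \<open>W\<close> is
    chosen for this.\<close>
  moreover have "\<gamma> / (4 * x\<^sup>2) - c * (\<gamma> / 2) * x powr (\<gamma> / 2) / x + (v x)\<^sup>2
      = c\<^sup>2 * x powr \<gamma> + \<gamma> / 4 * (\<gamma> / 4 + 1) / x\<^sup>2"
  proof -
    have "x powr \<gamma> = (x powr (\<gamma> / 2))\<^sup>2" using x by (simp add: power2_eq_square flip: powr_add)
    then show ?thesis unfolding v_def using x by (simp add: field_simps power2_eq_square)
  qed
  ultimately show "((\<lambda>x. v x * W x) has_real_derivative
            (c\<^sup>2 * x powr \<gamma> + \<gamma> / 4 * (\<gamma> / 4 + 1) / x\<^sup>2) * W x) (at x)" by simp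
qed

text \<open>Wherever f < f(1) W, one has f'' \<le> c^2 x^\<gamma> f < c^2 x^\<gamma> f(1) W \<le>
  f(1) W'', so the minimum principle applies to f - f(1) W on [1, \<infinity>).\<close>

lemma WKB_lower_bound:
  fixes f f1 f2 :: "real \<Rightarrow> real" and c \<gamma> \<alpha> :: real
  assumes d1: "\<And>x. 0 < x \<Longrightarrow> (f has_real_derivative f1 x) (at x)"
    and d2: "\<And>x. 0 < x \<Longrightarrow> (f1 has_real_derivative f2 x) (at x)"
    and nonneg: "\<And>x. 0 \<le> x \<Longrightarrow> 0 \<le> f x"
    and super: "\<And>x. 0 < x \<Longrightarrow> f2 x \<le> c\<^sup>2 * x powr \<gamma> * f x"
    and c: "0 < c" and \<gamma>: "0 \<le> \<gamma>" and \<alpha>: "\<alpha> = (\<gamma> + 2) / 2" and x: "1 \<le> x"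
  shows "f 1 * x powr (- \<gamma> / 4) * exp (- c * x powr \<alpha> / \<alpha>) \<le> f x"
proof -
  define W where "W x = x powr (- \<gamma> / 4) * exp (- c * x powr \<alpha> / \<alpha>)" for x
  define v where "v x = - \<gamma> / (4 * x) - c * x powr (\<gamma> / 2)" for x
  have a0: "0 < \<alpha>" using \<alpha> \<gamma> by simp
  have W1: "(W has_real_derivative v x * W x) (at x)" if "0 < x" for x
    using WKB_second_derivative(1)[OF \<alpha> a0 that] by (simp add: W_def[abs_def] v_def)
  have W2: "((\<lambda>x. v x * W x) has_real_derivative
      (c\<^sup>2 * x powr \<gamma> + \<gamma> / 4 * (\<gamma> / 4 + 1) / x\<^sup>2) * W x) (at x)" if "0 < x" for x
    using WKB_second_derivative(2)[OF \<alpha> a0 that, of c] by (simp add: W_def[abs_def] v_def[abs_def])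
  have Wpos: "0 \<le> W x" for x by (simp add: W_def)
  have Wlim: "(W \<longlongrightarrow> 0) at_top"
  proof (rule tendsto_sandwich)
    show "eventually (\<lambda>x. 0 \<le> W x) at_top" using Wpos by simp
    show "eventually (\<lambda>x. W x \<le> exp (- c * x powr \<alpha> / \<alpha>)) at_top"
      using eventually_ge_at_top[of 1]
    proof eventually_elim
      case (elim x)
      have "x powr (- \<gamma> / 4) \<le> 1 powr (- \<gamma> / 4)"
        using elim \<gamma> by (intro powr_mono2') auto
      then show ?case unfolding W_def by (intro mult_left_le_one_le) auto
    qed
    have "filterlim (\<lambda>x. x powr \<alpha>) at_top at_top" using a0 by real_asymp
    then have "filterlim (\<lambda>x. c / \<alpha> * x powr \<alpha>) at_top at_top"
      using c a0 by (intro filterlim_tendsto_pos_mult_at_top[OF tendsto_const]) auto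
    then have "((\<lambda>x. exp (- (c / \<alpha> * x powr \<alpha>))) \<longlongrightarrow> 0) at_top"
      by (intro filterlim_compose[OF exp_at_bot] filterlim_uminus_at_bot_at_top[THEN filterlim_compose])
    then show "((\<lambda>x. exp (- c * x powr \<alpha> / \<alpha>)) \<longlongrightarrow> 0) at_top" by simp
  qed simp
  have "0 \<le> f x - f 1 * W x"
  proof (rule min_principle_half_line[where c = 1 and h = "\<lambda>x. f x - f 1 * W x"])
    show D: "((\<lambda>x. f x - f 1 * W x) has_real_derivative f1 x - f 1 * (v x * W x)) (at x)"
      if "1 < x" for x
      using that by (intro DERIV_diff DERIV_cmult d1 W1) auto
    show "((\<lambda>x. f1 x - f 1 * (v x * W x)) has_real_derivative
        f2 x - f 1 * ((c\<^sup>2 * x powr \<gamma> + \<gamma> / 4 * (\<gamma> / 4 + 1) / x\<^sup>2) * W x)) (at x)"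
      if "1 < x" for x
      using that by (intro DERIV_diff DERIV_cmult d2 W2) auto
    show "continuous_on {1..} (\<lambda>x. f x - f 1 * W x)"
    proof (intro continuous_at_imp_continuous_on ballI)
      fix y :: real assume "y \<in> {1..}"
      then have "0 < y" by simp
      show "isCont (\<lambda>x. f x - f 1 * W x) y"
        by (intro continuous_intros DERIV_isCont[OF d1[OF \<open>0 < y\<close>]] DERIV_isCont[OF W1[OF \<open>0 < y\<close>]])
    qed
    \<comment> \<open>Since \<open>W 1 = exp (- c / \<alpha>)\<close> is at most 1, the factor
      \<open>f 1\<close> already gives the right sign at the left end.\<close>
    show "0 \<le> f 1 - f 1 * W 1"
    proof -
      have "W 1 \<le> 1" unfolding W_def using c a0 by simp
      then have "f 1 * W 1 \<le> f 1" using nonneg[of 1] by (intro mult_left_le) auto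
      then show ?thesis by simp
    qed
    show "eventually (\<lambda>x. - \<epsilon> < f x - f 1 * W x) at_top" if "0 < \<epsilon>" for \<epsilon> :: real
    proof -
      have "((\<lambda>x. f 1 * W x) \<longlongrightarrow> 0) at_top" using tendsto_mult_right_zero[OF Wlim] .
      then have "eventually (\<lambda>x. f 1 * W x < \<epsilon>) at_top" using that by (rule order_tendstoD)
      then show ?thesis using eventually_ge_at_top[of 0]
      proof eventually_elim
        case (elim x) then show ?case using nonneg[of x] by linarith
      qed
    qed
    show "f2 x - f 1 * ((c\<^sup>2 * x powr \<gamma> + \<gamma> / 4 * (\<gamma> / 4 + 1) / x\<^sup>2) * W x) < 0"
      if "1 < x" "f x - f 1 * W x < 0" for x
    proof -
      have "c\<^sup>2 * x powr \<gamma> * f x < c\<^sup>2 * x powr \<gamma> * (f 1 * W x)"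
        using that c by (intro mult_strict_left_mono) auto
      moreover have "0 \<le> f 1 * (\<gamma> / 4 * (\<gamma> / 4 + 1) / x\<^sup>2 * W x)"
        using Wpos \<gamma> nonneg[of 1] by (intro mult_nonneg_nonneg divide_nonneg_nonneg) auto
      moreover have "f 1 * ((c\<^sup>2 * x powr \<gamma> + \<gamma> / 4 * (\<gamma> / 4 + 1) / x\<^sup>2) * W x)
          = c\<^sup>2 * x powr \<gamma> * (f 1 * W x) + f 1 * (\<gamma> / 4 * (\<gamma> / 4 + 1) / x\<^sup>2 * W x)"
        by (simp only: ring_distribs mult_ac)
      ultimately show ?thesis using super[of x] that by linarith
    qed
  qed (use x in auto)
  then show ?thesis by (simp add: W_def mult_ac)
qed

section \<open>Moments of the second derivative\<close>

text \<open>The hypotheses on the profile use \<open>lebesgue\<close>, the fundamental theorem of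
  calculus uses \<open>lborel\<close>. Integrands without \<open>b\<close> are continuous on the
  open half-line, so their truncations are Borel and both notions of integrability agree.\<close>

lemma set_integrable_lebesgue_iff_lborel:
  fixes u :: "real \<Rightarrow> real"
  assumes "A \<in> sets borel" "continuous_on A u"
  shows "set_integrable lebesgue A u \<longleftrightarrow> set_integrable lborel A u"
  using borel_measurable_continuous_on_indicator[OF assms]
  unfolding set_integrable_def by (auto intro!: integrable_completion)

text \<open>The fundamental theorem on [c, b], followed by b \<rightarrow> \<infinity>. This and its
  counterpart at the left end produce limits of functions from the integrability of their
  derivatives.\<close>

lemma tendsto_at_top_of_integrable_derivative:
  fixes F h :: "real \<Rightarrow> real"
  assumes D: "\<And>x. c \<le> x \<Longrightarrow> (F has_real_derivative h x) (at x)"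
    and cont: "continuous_on {c..} h" and int: "set_integrable lborel {c..} h"
  shows "(F \<longlongrightarrow> F c + (LBINT x:{c..}. h x)) at_top"
proof -
  have "((\<lambda>b. F c + (LBINT x:{c..b}. h x)) \<longlongrightarrow> F c + (LBINT x:{c..}. h x)) at_top"
    using int by (intro tendsto_intros tendsto_set_lebesgue_integral_at_top) auto
  moreover have "eventually (\<lambda>b. F c + (LBINT x:{c..b}. h x) = F b) at_top"
    using eventually_ge_at_top[of c]
  proof eventually_elim
    case (elim b)
    have "(LBINT x:{c..b}. h x) = F b - F c" unfolding set_lebesgue_integral_def
      using elim D by (intro integral_FTC_atLeastAtMost continuous_on_subset[OF cont])
        (auto simp: has_real_derivative_iff_has_vector_derivative
          intro: has_vector_derivative_at_within)
    then show ?case by simp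
  qed
  ultimately show ?thesis by (rule Lim_transform_eventually)
qed

lemma tendsto_at_right_of_integrable_derivative:
  fixes F h :: "real \<Rightarrow> real"
  assumes D: "\<And>x. a < x \<Longrightarrow> x \<le> c \<Longrightarrow> (F has_real_derivative h x) (at x)"
    and cont: "continuous_on {a<..c} h" and int: "set_integrable lborel {a<..c} h" and "a < c"
  shows "(F \<longlongrightarrow> F c - (LBINT x:{a<..c}. h x)) (at_right a)"
proof -
  have "((\<lambda>b. F c - (LBINT x:{b..c}. h x)) \<longlongrightarrow> F c - (LBINT x:{a<..c}. h x)) (at_right a)"
    using int \<open>a < c\<close> by (intro tendsto_intros tendsto_set_lebesgue_integral_at_right) auto
  moreover have "eventually (\<lambda>b. b \<in> {a<..<c}) (at_right a)"
    using \<open>a < c\<close> by (rule eventually_at_right_real)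
  then have "eventually (\<lambda>b. F c - (LBINT x:{b..c}. h x) = F b) (at_right a)"
  proof eventually_elim
    case (elim b)
    have "(LBINT x:{b..c}. h x) = F c - F b" unfolding set_lebesgue_integral_def
      using elim D by (intro integral_FTC_atLeastAtMost continuous_on_subset[OF cont])
        (auto simp: has_real_derivative_iff_has_vector_derivative
          intro: has_vector_derivative_at_within)
    then show ?case by simp
  qed
  ultimately show ?thesis by (rule Lim_transform_eventually)
qed

lemma set_integral_derivative_half_line:
  fixes F h :: "real \<Rightarrow> real"
  assumes D: "\<And>x. a < x \<Longrightarrow> (F has_real_derivative h x) (at x)"
    and cont: "continuous_on {a<..} h" and int: "set_integrable lborel {a<..} h"
    and A: "(F \<longlongrightarrow> A) (at_right a)" and B: "(F \<longlongrightarrow> B) at_top"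
  shows "(LBINT x:{a<..}. h x) = B - A"
proof -
  have "(LBINT x=ereal a..\<infinity>. h x) = B - A"
  proof (rule interval_integral_FTC_integrable)
    show "(F has_vector_derivative h x) (at x)" if "ereal a < ereal x" for x
      using D[of x] that by (simp add: has_real_derivative_iff_has_vector_derivative)
    show "isCont h x" if "ereal a < ereal x" for x
      using cont that by (simp add: continuous_on_eq_continuous_at)
  qed (use int A B in \<open>auto simp: ereal_tendsto_simps\<close>)
  then show ?thesis by (simp add: interval_integral_to_infinity_eq)
qed

text \<open>A nonzero limit would keep |F| above |L|/2 on some half-line, so a nonzero constant
  would be integrable there and the half-line would have finite measure.\<close>

lemma integrable_tendsto_at_top_imp_0:
  fixes F :: "real \<Rightarrow> real"
  assumes int: "set_integrable lborel {c..} F" and lim: "(F \<longlongrightarrow> L) at_top"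
  shows "L = 0"
proof (rule ccontr)
  assume "L \<noteq> 0"
  have "((\<lambda>x. \<bar>F x\<bar>) \<longlongrightarrow> \<bar>L\<bar>) at_top" using lim by (rule tendsto_rabs)
  then have "eventually (\<lambda>x. \<bar>L\<bar> / 2 < \<bar>F x\<bar>) at_top"
    using \<open>L \<noteq> 0\<close> by (intro order_tendstoD) auto
  then obtain X where X: "\<And>x. X \<le> x \<Longrightarrow> \<bar>L\<bar> / 2 < \<bar>F x\<bar>" by (auto simp: eventually_at_top_linorder)
  define Y where "Y = max X c"
  have "set_integrable lborel {Y..} F"
    using int by (rule set_integrable_subset) (auto simp: Y_def)
  then have "set_integrable lborel {Y..} (\<lambda>x. \<bar>L\<bar> / 2)"
    by (rule set_integrable_bound)
      (use X in \<open>auto simp: Y_def set_borel_measurable_def intro!: AE_I2 less_imp_le\<close>)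
  then have "integrable lborel (\<lambda>x. indicat_real {Y..} x * (\<bar>L\<bar> / 2))"
    unfolding set_integrable_def by simp
  then have "integrable lborel (indicat_real {Y..})"
    using \<open>L \<noteq> 0\<close> integrable_mult_right_iff[of lborel "indicat_real {Y..}" "\<bar>L\<bar> / 2"] by simp
  then have "emeasure lborel {Y..} < \<infinity>" by (simp add: integrable_indicator_iff)
  then obtain r where r: "emeasure lborel {Y..} = ennreal r" "0 \<le> r"
    by (cases "emeasure lborel {Y..}") auto
  obtain n where n: "r < real n" using reals_Archimedean2 by blast
  have "emeasure lborel {Y..Y + real n} \<le> emeasure lborel {Y..}" by (intro emeasure_mono) auto
  then have "ennreal (real n) \<le> ennreal r" by (simp add: r)
  then show False using r n by (simp add: ennreal_le_iff)
qed

context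
  fixes f f1 f2 :: "real \<Rightarrow> real"
  assumes d1: "\<And>x. 0 < x \<Longrightarrow> (f has_real_derivative f1 x) (at x)"
    and d2: "\<And>x. 0 < x \<Longrightarrow> (f1 has_real_derivative f2 x) (at x)"
    and f2_cont: "continuous_on {0<..} f2"
    and f_0: "(f \<longlongrightarrow> 0) (at_right 0)"
    and f_int: "\<And>m. - 1 < m \<Longrightarrow> set_integrable lborel {0<..} (\<lambda>x. x powr m * f x)"
    and f2_int: "\<And>m. 1 \<le> m \<Longrightarrow> set_integrable lborel {0<..} (\<lambda>x. x powr m * f2 x)"
begin

text \<open>The boundary term of two integrations by parts of \<open>x powr m * f2 x\<close>: in its
  derivative the two terms with \<open>f1\<close> cancel, which leaves \<open>G'\<close>.\<close>

private definition G where "G m x = x powr m * f1 x - m * (x powr (m - 1) * f x)"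

private definition G' where "G' m x = x powr m * f2 x - m * (m - 1) * (x powr (m - 2) * f x)"

private lemma f_cont: "continuous_on {0<..} f"
  using d1 by (auto intro!: continuous_at_imp_continuous_on DERIV_isCont)

private lemma G_deriv: "(G m has_real_derivative G' m x) (at x)" if "0 < x"
proof -
  have p: "x powr (m - 1) = x powr (m - 2) * x"
    using that by (simp add: powr_diff field_simps power2_eq_square)
  show ?thesis
    unfolding G_def[abs_def] G'_def using that
    by (auto intro!: derivative_eq_intros d1 d2 simp: algebra_simps p)
qed

private lemma G'_cont: "continuous_on {0<..} (G' m)"
  unfolding G'_def[abs_def] by (auto intro!: continuous_intros f2_cont f_cont)

private lemma G'_int: "set_integrable lborel {0<..} (G' m)" if "1 \<le> m"
proof (cases "m = 1")
  \<comment> \<open>For \<open>m = 1\<close> the weight of \<open>f\<close> would be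
    \<open>x powr (- 1)\<close>, which \<open>f_int\<close> does not cover, but its coefficient
    \<open>m - 1\<close> vanishes.\<close>
  case True then show ?thesis using f2_int[of 1] by (simp add: G'_def[abs_def])
next
  case False
  then show ?thesis unfolding G'_def[abs_def]
    using that by (intro set_integral_diff set_integrable_mult_right f2_int f_int) auto
qed

private lemma G_tendsto_at_top: "\<exists>L. (G m \<longlongrightarrow> L) at_top" if "1 \<le> m"
  using tendsto_at_top_of_integrable_derivative[of 1 "G m" "G' m"]
    G_deriv continuous_on_subset[OF G'_cont, of "{1..}"]
    set_integrable_subset[OF G'_int[OF that], of "{1..}"]
  by force

private lemma G_tendsto_at_0: "\<exists>L. (G m \<longlongrightarrow> L) (at_right 0)" if "1 \<le> m"
  using tendsto_at_right_of_integrable_derivative[of 0 1 "G m" "G' m"]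
    G_deriv continuous_on_subset[OF G'_cont, of "{0<..1}"]
    set_integrable_subset[OF G'_int[OF that], of "{0<..1}"]
  by force

text \<open>The terms with \<open>f1\<close> agree on both sides. Comparing two consecutive weights
  therefore gives access to \<open>f\<close> alone, and also lowers the weight for which a limit
  must be known.\<close>

private lemma G_step: "G (m + 1) x = x * G m x - x powr m * f x" if "0 < x"
proof -
  have "x powr m = x * x powr (m - 1)" "x powr (m + 1) = x * x powr m"
    using that by (simp_all add: powr_diff powr_add)
  then show ?thesis by (simp add: G_def algebra_simps)
qed

text \<open>Decay comes from comparing two weights: \<open>G m\<close> and \<open>G (m + 1)\<close> both converge, and
  \<open>x powr (m - 1) * f x = G m x - G (m + 1) x / x\<close>, so the left-hand side converges; being
  integrable, it tends to 0.\<close>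

lemma weighted_profile_tendsto_0: "((\<lambda>x. x powr (m - 1) * f x) \<longlongrightarrow> 0) at_top"
  and G_tendsto_0_at_top: "(G m \<longlongrightarrow> 0) at_top"
  if m: "1 \<le> m"
proof -
  obtain L where L: "(G m \<longlongrightarrow> L) at_top" using G_tendsto_at_top[OF m] by blast
  obtain M where M: "(G (m + 1) \<longlongrightarrow> M) at_top" using G_tendsto_at_top[of "m + 1"] m by auto
  have "((\<lambda>x. G m x - G (m + 1) x * inverse x) \<longlongrightarrow> L - M * 0) at_top"
    by (intro tendsto_intros L M tendsto_inverse_0_at_top filterlim_ident)
  moreover have "eventually (\<lambda>x. G m x - G (m + 1) x * inverse x = x powr (m - 1) * f x) at_top"
    using eventually_gt_at_top[of 0]
  proof eventually_elim
    case (elim x) then show ?case using G_step[OF elim, of m] by (simp add: field_simps powr_diff)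
  qed
  ultimately have "((\<lambda>x. x powr (m - 1) * f x) \<longlongrightarrow> L - M * 0) at_top"
    by (rule Lim_transform_eventually)
  then have lim: "((\<lambda>x. x powr (m - 1) * f x) \<longlongrightarrow> L) at_top" by simp
  have "set_integrable lborel {1..} (\<lambda>x. x powr (m - 1) * f x)"
    using m by (intro set_integrable_subset[OF f_int[of "m - 1"]]) auto
  from integrable_tendsto_at_top_imp_0[OF this lim] have "L = 0" .
  then show "((\<lambda>x. x powr (m - 1) * f x) \<longlongrightarrow> 0) at_top" "(G m \<longlongrightarrow> 0) at_top"
    using lim L by auto
qed

text \<open>By \<open>G_step\<close>, \<open>G m\<close> is x times the convergent
  \<open>G (m - 1)\<close>, minus a positive power of x times \<open>f\<close>. The bound on
  \<open>m\<close> ensures that \<open>G (m - 1)\<close> converges.\<close>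

private lemma G_tendsto_0_at_0: "(G m \<longlongrightarrow> 0) (at_right 0)" if m: "2 \<le> m"
proof -
  obtain L where L: "(G (m - 1) \<longlongrightarrow> L) (at_right 0)"
    using G_tendsto_at_0[of "m - 1"] m by auto
  have p: "((\<lambda>x::real. x powr (m - 1)) \<longlongrightarrow> 0) (at_right 0)"
    using m by (intro tendsto_zero_powrI tendsto_ident_at tendsto_const) (auto simp: eventually_at_filter)
  have "((\<lambda>x. x * G (m - 1) x - x powr (m - 1) * f x) \<longlongrightarrow> 0 * L - 0 * 0) (at_right 0)"
    by (intro tendsto_intros L p f_0)
  moreover have "eventually (\<lambda>x. x * G (m - 1) x - x powr (m - 1) * f x = G m x) (at_right 0)"
    using eventually_at_right_less[of 0]
    by eventually_elim (use G_step[of _ "m - 1"] in simp)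
  ultimately have "(G m \<longlongrightarrow> 0 * L - 0 * 0) (at_right 0)" by (rule Lim_transform_eventually)
  then show ?thesis by simp
qed

text \<open>Two integrations by parts, collected in the single antiderivative \<open>G m\<close>,
  whose limits at both ends are 0. The bound on \<open>m\<close> enters through the limit at
  0.\<close>

lemma second_derivative_moment:
  assumes "2 \<le> m"
  shows "(LBINT x:{0<..}. x powr m * f2 x) = m * (m - 1) * (LBINT x:{0<..}. x powr (m - 2) * f x)"
proof -
  have "(LBINT x:{0<..}. G' m x) = 0 - 0"
    using assms by (intro set_integral_derivative_half_line[where F = "G m"] G_deriv G'_cont G'_int
        G_tendsto_0_at_0 G_tendsto_0_at_top) auto
  moreover have "(LBINT x:{0<..}. G' m x) = (LBINT x:{0<..}. x powr m * f2 x)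
      - m * (m - 1) * (LBINT x:{0<..}. x powr (m - 2) * f x)"
    unfolding G'_def using assms by (subst set_integral_diff) (auto intro!: f2_int f_int)
  ultimately show ?thesis by simp
qed

text \<open>Taylor's formula with the base point moved to infinity: \<open>H\<close> is an
  antiderivative of the integrand with \<open>H x = - f x\<close>, and it vanishes at infinity
  because \<open>H = G 1 - x * f1\<close> there.\<close>

lemma profile_eq_integral:
  assumes x: "0 < x"
  shows "set_integrable lborel {x<..} (\<lambda>y. (y - x) * f2 y)" (is ?I)
    and "f x = (LBINT y:{x<..}. (y - x) * f2 y)"
proof -
  define H where "H y = (y - x) * f1 y - f y" for y
  show I: ?I
  proof (rule set_integrable_bound)
    show "set_integrable lborel {x<..} (\<lambda>y. y powr 1 * f2 y)"
      using x by (intro set_integrable_subset[OF f2_int[of 1]]) auto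
    show "set_borel_measurable lborel {x<..} (\<lambda>y. (y - x) * f2 y)"
      unfolding set_borel_measurable_def using x
      by (subst measurable_lborel2) (intro borel_measurable_continuous_on_indicator continuous_intros
            continuous_on_subset[OF f2_cont]; auto)
    show "AE y in lborel. y \<in> {x<..} \<longrightarrow> norm ((y - x) * f2 y) \<le> norm (y powr 1 * f2 y)"
      using x by (auto simp: abs_mult intro!: AE_I2 mult_right_mono)
  qed
  have "(H \<longlongrightarrow> 0 - x * 0) at_top"
  \<comment> \<open>Only \<open>f1\<close> still needs a limit. Since
    \<open>G 2 y = y\<^sup>2 * f1 y - 2 * y * f y\<close>, the product \<open>y * f1 y\<close> tends
    to 0, and so does \<open>f1 y\<close>.\<close>
  proof (rule Lim_transform_eventually)
    have "((\<lambda>y. (G 2 y + 2 * (y powr (2 - 1) * f y)) * inverse y) \<longlongrightarrow> (0 + 2 * 0) * 0) at_top"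
      by (intro tendsto_intros G_tendsto_0_at_top weighted_profile_tendsto_0 filterlim_ident
          tendsto_inverse_0_at_top) auto
    moreover have "eventually (\<lambda>y. (G 2 y + 2 * (y powr (2 - 1) * f y)) * inverse y = y * f1 y) at_top"
      using eventually_gt_at_top[of 0]
      by eventually_elim (simp add: G_def field_simps power2_eq_square)
    ultimately have "((\<lambda>y. y * f1 y) \<longlongrightarrow> (0 + 2 * 0) * 0) at_top"
      by (rule Lim_transform_eventually)
    then have "((\<lambda>y. y * f1 y) \<longlongrightarrow> 0) at_top" by simp
    then have "((\<lambda>y. y * f1 y * inverse y) \<longlongrightarrow> 0 * 0) at_top"
      by (intro tendsto_intros filterlim_ident tendsto_inverse_0_at_top)
    moreover have "eventually (\<lambda>y. y * f1 y * inverse y = f1 y) at_top"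
      using eventually_gt_at_top[of 0] by eventually_elim simp
    ultimately have "(f1 \<longlongrightarrow> 0 * 0) at_top" by (rule Lim_transform_eventually)
    then have "(f1 \<longlongrightarrow> 0) at_top" by simp
    then show "((\<lambda>y. G 1 y - x * f1 y) \<longlongrightarrow> 0 - x * 0) at_top"
      by (intro tendsto_intros G_tendsto_0_at_top) auto
    show "eventually (\<lambda>y. G 1 y - x * f1 y = H y) at_top"
      using eventually_gt_at_top[of 0]
      by eventually_elim (simp add: G_def H_def algebra_simps)
  qed
  moreover have H: "(H has_real_derivative (y - x) * f2 y) (at y)" if "0 < y" for y
    unfolding H_def using that x by (auto intro!: derivative_eq_intros d1 d2)
  then have "isCont H x" using x by (intro DERIV_isCont)
  then have "(H \<longlongrightarrow> H x) (at_right x)"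
    by (simp add: continuous_at continuous_within filterlim_at_split)
  ultimately have "(LBINT y:{x<..}. (y - x) * f2 y) = 0 - x * 0 - H x"
    using x H by (intro set_integral_derivative_half_line[where F = H] I)
      (auto intro!: continuous_intros continuous_on_subset[OF f2_cont])
  then show "f x = (LBINT y:{x<..}. (y - x) * f2 y)" by (simp add: H_def)
qed

end

section \<open>Moments of the gain term\<close>

text \<open>A Lebesgue measurable function on the plane need not be measurable for the product of the two
  Lebesgue sigma algebras, so Tonelli's theorem applies only after a modification on a null set.\<close>

lemma nn_integral_lebesgue_Fubini:
  fixes B :: "real \<Rightarrow> real \<Rightarrow> ennreal"
  assumes B: "(\<lambda>(x, y). B x y) \<in> borel_measurable lebesgue"
  shows "(\<integral>\<^sup>+x. (\<integral>\<^sup>+y. B x y \<partial>lebesgue) \<partial>lebesgue) = (\<integral>\<^sup>+y. (\<integral>\<^sup>+x. B x y \<partial>lebesgue) \<partial>lebesgue)"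
proof -
  obtain B' where B' [measurable]: "B' \<in> borel_measurable (borel :: (real \<times> real) measure)"
    and "AE z in lborel. (case z of (x, y) \<Rightarrow> B x y) = B' z"
    using completion_ex_borel_measurable[OF B] by auto
  then obtain N :: "(real \<times> real) set" where N: "N \<in> null_sets lborel"
    "{z. (case z of (x, y) \<Rightarrow> B x y) \<noteq> B' z} \<subseteq> N"
    by (auto elim!: AE_E simp: null_sets_def)
  have BB: "B x y = B' (x, y)" if "(x, y) \<notin> N" for x y 
  proof (rule ccontr)
    assume "B x y \<noteq> B' (x, y)"
    then have "(x, y) \<in> {z. (case z of (x, y) \<Rightarrow> B x y) \<noteq> B' z}" by simp
    then show False using N(2) that by blast
  qed
  have AN: "AE z in lborel \<Otimes>\<^sub>M lborel. z \<notin> N"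
    unfolding lborel_prod using N(1) by (rule AE_not_in)
  have NS [measurable]: "N \<in> sets (borel \<Otimes>\<^sub>M borel)"
    unfolding borel_prod using N(1) by (auto simp: null_sets_def)
  \<comment> \<open>Almost every section of the planar null set \<open>N\<close> is null, in either
    direction, so replacing \<open>B\<close> by \<open>B'\<close> changes neither iterated
    integral.\<close>
  have xy: "AE x in lborel. AE y in lborel. (x, y) \<notin> N"
    using lborel_pair.AE_pair[OF AN] .
  have yx: "AE y in lborel. AE x in lborel. (x, y) \<notin> N"
    using xy by (subst (asm) lborel_pair.AE_commute) measurable
  have "(\<integral>\<^sup>+x. (\<integral>\<^sup>+y. B x y \<partial>lebesgue) \<partial>lebesgue) = (\<integral>\<^sup>+x. (\<integral>\<^sup>+y. B' (x, y) \<partial>lborel) \<partial>lborel)"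
    unfolding nn_integral_completion using xy BB
    by (intro nn_integral_cong_AE) (auto elim!: eventually_mono intro!: nn_integral_cong_AE)
  also have "\<dots> = (\<integral>\<^sup>+y. (\<integral>\<^sup>+x. B' (x, y) \<partial>lborel) \<partial>lborel)"
    by (rule lborel_pair.Fubini'[symmetric]) (simp add: lborel_prod)
  also have "\<dots> = (\<integral>\<^sup>+y. (\<integral>\<^sup>+x. B x y \<partial>lebesgue) \<partial>lebesgue)"
    unfolding nn_integral_completion using yx BB
    by (intro nn_integral_cong_AE) (auto elim!: eventually_mono intro!: nn_integral_cong_AE)
  finally show ?thesis .
qed

lemma borel_measurable_lebesgue_fst_snd:
  fixes u :: "real \<Rightarrow> ennreal"
  assumes [measurable]: "u \<in> borel_measurable borel"
  shows "(\<lambda>(x, y). u x) \<in> borel_measurable (lebesgue :: (real \<times> real) measure)"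
    and "(\<lambda>(x, y). u y) \<in> borel_measurable (lebesgue :: (real \<times> real) measure)"
  by (intro measurable_completion; simp add: borel_prod[symmetric])+

text \<open>Tonelli's theorem turns the moment of the gain term into the integral of u(y) times the
  m-th moment of b(., y) over (0, y), which \<open>b_le\<close> bounds. The exchange takes place in
  \<open>ennreal\<close>; \<open>g_int\<close> and \<open>u_int\<close> lead back to real
  integrals.\<close>

lemma gain_moment_le:
  fixes u g :: "real \<Rightarrow> real" and b :: "real \<Rightarrow> real \<Rightarrow> real" and m \<beta> :: real
  assumes b_meas: "(\<lambda>(x, y). b x y) \<in> borel_measurable (lebesgue_on {(x, y). 0 < x \<and> x < y})"
    and b_nonneg: "\<And>x y. 0 < x \<Longrightarrow> x < y \<Longrightarrow> 0 \<le> b x y"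
    and u_cont: "continuous_on {0<..} u" and u_nonneg: "\<And>y. 0 < y \<Longrightarrow> 0 \<le> u y"
    and g: "\<And>x. 0 < x \<Longrightarrow> set_integrable lebesgue {x<..} (\<lambda>y. u y * b x y)"
      "\<And>x. 0 < x \<Longrightarrow> g x = (LINT y:{x<..}|lebesgue. u y * b x y)"
    and b_int: "\<And>y. 0 < y \<Longrightarrow> set_integrable lebesgue {0<..<y} (\<lambda>x. x powr m * b x y)"
    and b_le: "\<And>y. 0 < y \<Longrightarrow> (LINT x:{0<..<y}|lebesgue. x powr m * b x y) \<le> \<beta> * y powr m"
    and g_int: "set_integrable lborel {0<..} (\<lambda>x. x powr m * g x)"
    and u_int: "set_integrable lborel {0<..} (\<lambda>x. x powr m * u x)"
    and \<beta>: "0 \<le> \<beta>"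
  shows "(LBINT x:{0<..}. x powr m * g x) \<le> \<beta> * (LBINT x:{0<..}. x powr m * u x)"
proof -
  \<comment> \<open>Nothing is known about \<open>b\<close> outside the wedge 0 < x < y. The
    indicator removes those values and makes \<open>B\<close> measurable on the whole plane.\<close>
  define B where "B x y = ennreal (b x y) * indicator {(x, y). 0 < x \<and> x < y} (x, y)" for x y
  define U where "U y = ennreal (indicator {0<..} y * u y)" for y
  define P where "P x = ennreal (indicator {0<..} x * x powr m)" for x :: real
  have S: "{(x, y). 0 < x \<and> x < (y::real)} \<in> sets borel"
    unfolding case_prod_beta' by (intro borel_open open_Collect_conj open_Collect_less continuous_intros)
  have Bm: "(\<lambda>(x, y). B x y) \<in> borel_measurable lebesgue"
  proof -
    have "(\<lambda>z. ennreal (case z of (x, y) \<Rightarrow> b x y)) \<in> borel_measurable (lebesgue_on {(x, y). 0 < x \<and> x < y})"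
      using b_meas by measurable
    then have "(\<lambda>z. ennreal (case z of (x, y) \<Rightarrow> b x y) * indicator {(x, y). 0 < x \<and> x < y} z)
        \<in> borel_measurable lebesgue"
      using S by (subst (asm) borel_measurable_restrict_space_iff_ennreal) auto
    then show ?thesis by (simp add: B_def case_prod_beta')
  qed
  have Um [measurable]: "U \<in> borel_measurable borel"
    using borel_measurable_continuous_on_indicator[OF _ u_cont] by (simp add: U_def[abs_def])
  have Pm [measurable]: "P \<in> borel_measurable borel" unfolding P_def by measurable
  have gP: "ennreal (indicator {0<..} x * (x powr m * g x)) = (\<integral>\<^sup>+y. P x * (B x y * U y) \<partial>lebesgue)" for x
  proof (cases "0 < x")
    case True
    have "(\<integral>\<^sup>+y. ennreal (indicator {x<..} y *\<^sub>R (u y * b x y)) \<partial>lebesgue) = ennreal (g x)"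
      unfolding g(2)[OF True] set_lebesgue_integral_def
      using g(1)[OF True] True u_nonneg b_nonneg unfolding set_integrable_def
      by (intro nn_integral_eq_integral) (auto simp: indicator_def)
    moreover have "ennreal (indicator {x<..} y *\<^sub>R (u y * b x y)) = B x y * U y" for y
      using True u_nonneg[of y] b_nonneg[of x y]
      by (auto simp: B_def U_def indicator_def ennreal_mult' mult.commute)
    ultimately have 1: "(\<integral>\<^sup>+y. B x y * U y \<partial>lebesgue) = ennreal (g x)" by simp
    have "(\<lambda>y. B x y * U y) \<in> borel_measurable lebesgue"
    proof -
      have "(\<lambda>y. ennreal (indicator {x<..} y *\<^sub>R (u y * b x y))) \<in> borel_measurable lebesgue"
        using g(1)[OF True] unfolding set_integrable_def by measurable
      then show ?thesis using \<open>\<And>y. ennreal (indicator {x<..} y *\<^sub>R (u y * b x y)) = B x y * U y\<close> by simp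
    qed
    then have "(\<integral>\<^sup>+y. P x * (B x y * U y) \<partial>lebesgue) = P x * ennreal (g x)"
      by (simp add: nn_integral_cmult 1)
    also have "\<dots> = ennreal (x powr m * g x)" using True by (simp add: P_def ennreal_mult')
    finally show ?thesis using True by simp
  qed (simp add: P_def)
  have Bu: "(\<integral>\<^sup>+x. P x * (B x y * U y) \<partial>lebesgue) \<le> ennreal (\<beta> * (indicator {0<..} y * (y powr m * u y)))" for y
  proof (cases "0 < y")
    case True
    have "(\<integral>\<^sup>+x. ennreal (indicator {0<..<y} x *\<^sub>R (x powr m * b x y)) \<partial>lebesgue)
        = ennreal (LINT x:{0<..<y}|lebesgue. x powr m * b x y)"
      unfolding set_lebesgue_integral_def
      using b_int[OF True] b_nonneg unfolding set_integrable_def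
      by (intro nn_integral_eq_integral) (auto simp: indicator_def)
    also have "\<dots> \<le> ennreal (\<beta> * y powr m)" using b_le[OF True] by (rule ennreal_leI)
    finally have 1: "(\<integral>\<^sup>+x. ennreal (indicator {0<..<y} x *\<^sub>R (x powr m * b x y)) \<partial>lebesgue)
        \<le> ennreal (\<beta> * y powr m)" .
    have 2: "P x * (B x y * U y) = U y * ennreal (indicator {0<..<y} x *\<^sub>R (x powr m * b x y))" for x
      using True b_nonneg[of x y]
      by (auto simp: B_def P_def indicator_def ennreal_mult' mult_ac)
    have "(\<lambda>x. ennreal (indicator {0<..<y} x *\<^sub>R (x powr m * b x y))) \<in> borel_measurable lebesgue"
      using b_int[OF True] unfolding set_integrable_def by measurable
    then have "(\<integral>\<^sup>+x. P x * (B x y * U y) \<partial>lebesgue)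
        = U y * (\<integral>\<^sup>+x. ennreal (indicator {0<..<y} x *\<^sub>R (x powr m * b x y)) \<partial>lebesgue)"
      unfolding 2 by (rule nn_integral_cmult)
    also have "\<dots> \<le> U y * ennreal (\<beta> * y powr m)" using 1 by (rule mult_left_mono) simp
    also have "\<dots> = ennreal (\<beta> * (indicator {0<..} y * (y powr m * u y)))"
      using True \<beta> u_nonneg[OF True] by (simp add: U_def mult_ac flip: ennreal_mult)
    finally show ?thesis .
  qed (simp add: U_def)
  have g_nonneg: "0 \<le> g x" if "0 < x" for x
    unfolding g(2)[OF that] set_lebesgue_integral_def using that u_nonneg b_nonneg
    by (intro Bochner_Integration.integral_nonneg) (auto simp: indicator_def)
  have "ennreal (LBINT x:{0<..}. x powr m * g x) = (\<integral>\<^sup>+x. ennreal (indicator {0<..} x * (x powr m * g x)) \<partial>lborel)"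
    using g_int g_nonneg unfolding set_integrable_def set_lebesgue_integral_def
    by (subst nn_integral_eq_integral) (auto simp: indicator_def)
  also have "\<dots> = (\<integral>\<^sup>+x. (\<integral>\<^sup>+y. P x * (B x y * U y) \<partial>lebesgue) \<partial>lebesgue)"
    unfolding gP nn_integral_completion ..
  also have "\<dots> = (\<integral>\<^sup>+y. (\<integral>\<^sup>+x. P x * (B x y * U y) \<partial>lebesgue) \<partial>lebesgue)"
  proof (rule nn_integral_lebesgue_Fubini)
    have "(\<lambda>z. (case z of (x, y) \<Rightarrow> P x) * ((case z of (x, y) \<Rightarrow> B x y) * (case z of (x, y) \<Rightarrow> U y)))
        \<in> borel_measurable lebesgue"
      by (intro borel_measurable_times_ennreal Bm borel_measurable_lebesgue_fst_snd Um Pm)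
    then show "(\<lambda>(x, y). P x * (B x y * U y)) \<in> borel_measurable lebesgue"
      by (simp add: case_prod_beta')
  qed
  also have "\<dots> \<le> (\<integral>\<^sup>+y. ennreal (\<beta> * (indicator {0<..} y * (y powr m * u y))) \<partial>lborel)"
    unfolding nn_integral_completion using Bu unfolding nn_integral_completion by (intro nn_integral_mono)
  also have "\<dots> = ennreal (\<beta> * (LBINT x:{0<..}. x powr m * u x))"
    using u_int u_nonneg \<beta> unfolding set_integrable_def set_lebesgue_integral_def
    by (subst nn_integral_eq_integral) (auto simp: indicator_def)
  finally show ?thesis
  proof (rule ennreal_le_iff[THEN iffD1, rotated])
    show "0 \<le> \<beta> * (LBINT x:{0<..}. x powr m * u x)"
      unfolding set_lebesgue_integral_def using \<beta> u_nonneg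
      by (intro mult_nonneg_nonneg Bochner_Integration.integral_nonneg) (auto simp: indicator_def)
  qed
qed

section \<open>Summability of the moments\<close>

lemma cosh_series: "(\<lambda>k. t ^ (2 * k) / fact (2 * k)) sums cosh (t :: real)"
proof -
  have "strict_mono (\<lambda>k::nat. 2 * k)" by (simp add: strict_mono_def)
  moreover have "even n \<Longrightarrow> n \<in> range (\<lambda>k::nat. 2 * k)" for n by (auto elim: evenE)
  ultimately show ?thesis
    using sums_mono_reindex[of "\<lambda>k. 2 * k" "\<lambda>n. if even n then t ^ n /\<^sub>R fact n else 0" "cosh t"]
      cosh_converges[of t] by (force simp: divide_inverse_commute)
qed

text \<open>As k/(2k)! = 1/(2 (2k-1)!) for k \<ge> 1, the weight k turns the series of cosh into t/2
  times that of sinh; equivalently, this is (t/2) d/dt applied to cosh.\<close>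

lemma cosh_series_weighted_index:
  "(\<lambda>k. real k * (t ^ (2 * k) / fact (2 * k))) sums (t / 2 * sinh (t :: real))"
proof -
  define s where "s n = (if even n then 0 else t ^ n /\<^sub>R fact n)" for n
  have "(\<lambda>k. s (2 * k + 1)) sums sinh t \<longleftrightarrow> s sums sinh t"
  proof (rule sums_mono_reindex)
    show "strict_mono (\<lambda>k::nat. 2 * k + 1)" by (simp add: strict_mono_def)
    show "s n = 0" if "n \<notin> range (\<lambda>k. 2 * k + 1)" for n
    proof -
      have "even n" using that by (metis oddE rangeI)
      then show ?thesis by (simp add: s_def)
    qed
  qed
  then have "(\<lambda>k. t ^ (2 * k + 1) / fact (2 * k + 1)) sums sinh t"
    using sinh_converges[of t] by (simp add: s_def[abs_def] divide_inverse_commute)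
  then have "(\<lambda>k. t / 2 * (t ^ (2 * k + 1) / fact (2 * k + 1))) sums (t / 2 * sinh t)"
    by (rule sums_mult)
  moreover have "t / 2 * (t ^ (2 * k + 1) / fact (2 * k + 1))
      = real (Suc k) * (t ^ (2 * Suc k) / fact (2 * Suc k))" for k
  proof -
    define A where "A = (fact (2 * k + 1) :: real)"
    have 1: "fact (2 * Suc k) = 2 * real (Suc k) * A" by (simp add: A_def algebra_simps)
    have 2: "t ^ (2 * Suc k) = t * t ^ (2 * k + 1)" by simp
    have *: "t / 2 * (T / A) = n * (t * T / (2 * n * A))" if "0 < n" for n T :: real
      using that by simp
    show ?thesis unfolding 1 2 A_def[symmetric] by (rule *) simp
  qed
  ultimately have "(\<lambda>k. real (Suc k) * (t ^ (2 * Suc k) / fact (2 * Suc k))) sums (t / 2 * sinh t)"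
    by simp
  then show ?thesis using sums_Suc[of "\<lambda>k. real k * (t ^ (2 * k) / fact (2 * k))"] by simp
qed

text \<open>The tangent at 1 lies below the convex function z^(-q); here this follows from ln z
  \<le> z - 1 and 1 + y \<le> exp y.\<close>

lemma powr_neg_ge_tangent:
  fixes z q :: real
  assumes "0 < z" "0 \<le> q"
  shows "1 - q * (z - 1) \<le> z powr (- q)"
proof -
  have "1 - q * (z - 1) \<le> 1 + (- q * ln z)"
    using ln_le_minus_one[OF assms(1)] assms(2) by (simp add: mult_left_mono)
  also have "\<dots> \<le> exp (- q * ln z)" by (rule exp_ge_add_one_self)
  finally show ?thesis using assms(1) by (simp add: powr_def)
qed

text \<open>Jensen's inequality for the convex function \<open>u \<mapsto> u powr (-q)\<close> and the weights of the
  hyperbolic cosine series, whose mean index is at most \<open>t / 2\<close>.\<close>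

lemma cosh_series_powr_weight_ge:
  fixes t q :: real
  assumes t: "0 \<le> t" and q: "0 \<le> q"
  defines "w \<equiv> \<lambda>k. t ^ (2 * k) / fact (2 * k) * (1 + real k) powr (- q)"
  shows "summable w" and "(1 + t / 2) powr (- q) * cosh t \<le> suminf w"
proof -
  define u where "u = 1 + t / 2"
  define v where "v k = t ^ (2 * k) / fact (2 * k)" for k :: nat
  have u: "0 < u" using t by (simp add: u_def)
  have v0: "0 \<le> v k" for k using t by (simp add: v_def)
  show sw: "summable w"
  proof (rule summable_comparison_test)
    show "summable v" using cosh_series[of t] by (auto simp: v_def[abs_def] sums_iff)
    have "(1 + real k) powr (- q) \<le> 1" for k
      using powr_mono2'[of "- q" 1 "1 + real k"] q by simp
    then have "norm (w k) \<le> v k" for k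
      using v0[of k] by (simp add: w_def flip: v_def) (simp add: mult_left_le)
    then show "\<exists>N. \<forall>n\<ge>N. norm (w n) \<le> v n" by blast
  qed
  have sums: "(\<lambda>k. u powr (- q) * ((1 + q) * v k - q / u * (v k + real k * v k)))
      sums (u powr (- q) * ((1 + q) * cosh t - q / u * (cosh t + t / 2 * sinh t)))"
    using cosh_series[of t] cosh_series_weighted_index[of t] unfolding v_def
    by (intro sums_mult sums_diff sums_add)
  \<comment> \<open>The tangent bound at z = (1 + k)/u, multiplied by
    \<open>u powr (- q) * v k\<close>. Its slope term is affine in k, so the lower bound sums in
    closed form.\<close>
  have le: "u powr (- q) * ((1 + q) * v k - q / u * (v k + real k * v k)) \<le> w k" for k
  proof -
    have z: "0 < (1 + real k) / u" using u by simp
    have "u powr (- q) * v k * (1 - q * ((1 + real k) / u - 1))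
        \<le> u powr (- q) * v k * ((1 + real k) / u) powr (- q)"
      using powr_neg_ge_tangent[OF z q] v0 by (intro mult_left_mono) auto
    also have "\<dots> = w k" using u by (simp add: w_def v_def powr_divide)
    finally show ?thesis using u by (simp add: field_simps)
  qed
  have "u powr (- q) * ((1 + q) * cosh t - q / u * (cosh t + t / 2 * sinh t)) \<le> suminf w"
    by (rule sums_le[OF le sums summable_sums[OF sw]])
  moreover have "cosh t + t / 2 * sinh t \<le> u * cosh t"
    using t sinh_less_cosh_real[of t] by (simp add: u_def algebra_simps mult_left_mono)
  then have "q / u * (cosh t + t / 2 * sinh t) \<le> q / u * (u * cosh t)"
    using q u by (intro mult_left_mono) auto
  then have "cosh t \<le> (1 + q) * cosh t - q / u * (cosh t + t / 2 * sinh t)"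
    using u by (simp add: algebra_simps)
  then have "u powr (- q) * cosh t \<le> u powr (- q) * ((1 + q) * cosh t - q / u * (cosh t + t / 2 * sinh t))"
    by (intro mult_left_mono) auto
  ultimately show "(1 + t / 2) powr (- q) * cosh t \<le> suminf w" by (simp add: u_def)
qed

text \<open>In the variable \<open>z = 1 / k\<close> the limit is the derivative at 0 of a function \<open>F\<close> with \<open>F 0 = 1\<close>.\<close>

lemma moment_ratio_limit:
  fixes \<alpha> \<sigma> chi q :: real
  assumes \<alpha>: "0 < \<alpha>"
  shows "(\<lambda>k. real k * (\<alpha>\<^sup>2 * (2 * real k + 1) * (2 * real k + 2) * (\<sigma> + 2 * \<alpha> * real k - chi)
      / ((\<sigma> + 2 * \<alpha> * real k)\<^sup>2 * (\<sigma> + 2 * \<alpha> * real k - 1)) * ((real k + 2) / (real k + 1)) powr q - 1))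
    \<longlonglongrightarrow> q + 3 / 2 - (2 * \<sigma> + chi - 1) / (2 * \<alpha>)"
proof -
  \<comment> \<open>Numerator and denominator of the ratio are divided by k^3.\<close>
  define F where "F z = \<alpha>\<^sup>2 * (2 + z) * (2 + 2 * z) * (2 * \<alpha> + (\<sigma> - chi) * z)
      / ((2 * \<alpha> + \<sigma> * z)\<^sup>2 * (2 * \<alpha> + (\<sigma> - 1) * z)) * ((1 + 2 * z) / (1 + z)) powr q" for z
  have F0: "F 0 = 1" using \<alpha> by (simp add: F_def power2_eq_square)
  \<comment> \<open>As F(0) = 1, the derivative is the sum of the logarithmic derivatives of the
    factors: 1/2 + 1 + (\<sigma> - chi)/(2\<alpha>) - \<sigma>/\<alpha> - (\<sigma> - 1)/(2\<alpha>)
    + q.\<close>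
  have "(F has_real_derivative q + 3 / 2 - (2 * \<sigma> + chi - 1) / (2 * \<alpha>)) (at 0)"
    unfolding F_def using \<alpha>
    by (auto intro!: derivative_eq_intros) (simp add: field_simps power2_eq_square)
  then have "((\<lambda>z. (F z - F 0) / (z - 0)) \<longlongrightarrow> q + 3 / 2 - (2 * \<sigma> + chi - 1) / (2 * \<alpha>)) (at 0)"
    by (simp only: has_field_derivative_iff)
  moreover have "filterlim (\<lambda>k. 1 / real k) (at 0) sequentially"
    by real_asymp
  ultimately have "(\<lambda>k. (F (1 / real k) - F 0) / (1 / real k - 0))
      \<longlonglongrightarrow> q + 3 / 2 - (2 * \<sigma> + chi - 1) / (2 * \<alpha>)"
    by (rule filterlim_compose)
  moreover have "eventually (\<lambda>k. (F (1 / real k) - F 0) / (1 / real k - 0)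
      = real k * (\<alpha>\<^sup>2 * (2 * real k + 1) * (2 * real k + 2) * (\<sigma> + 2 * \<alpha> * real k - chi)
      / ((\<sigma> + 2 * \<alpha> * real k)\<^sup>2 * (\<sigma> + 2 * \<alpha> * real k - 1)) * ((real k + 2) / (real k + 1)) powr q - 1))
      sequentially"
    using eventually_gt_at_top[of 0]
  proof eventually_elim
    case (elim k)
    define K where "K = real k"
    have K: "0 < K" using elim by (simp add: K_def)
    have 1: "\<alpha>\<^sup>2 * (2 + 1 / K) * (2 + 2 * (1 / K)) * (2 * \<alpha> + (\<sigma> - chi) * (1 / K))
        = \<alpha>\<^sup>2 * (2 * K + 1) * (2 * K + 2) * (\<sigma> + 2 * \<alpha> * K - chi) / K ^ 3"
      using K by (simp add: field_simps power3_eq_cube)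
    have 2: "(2 * \<alpha> + \<sigma> * (1 / K))\<^sup>2 * (2 * \<alpha> + (\<sigma> - 1) * (1 / K))
        = (\<sigma> + 2 * \<alpha> * K)\<^sup>2 * (\<sigma> + 2 * \<alpha> * K - 1) / K ^ 3"
      using K by (simp add: field_simps power3_eq_cube power2_eq_square)
    have 3: "(1 + 2 * (1 / K)) / (1 + 1 / K) = (K + 2) / (K + 1)"
    proof -
      have "1 + 2 * (1 / K) = (K + 2) / K" "1 + 1 / K = (K + 1) / K"
        using K by (simp_all add: field_simps)
      then show ?thesis using K by simp
    qed
    show ?case
      unfolding F0 unfolding F_def K_def[symmetric] 1 2 3 using K by simp
  qed
  ultimately show ?thesis by (rule Lim_transform_eventually)
qed

text \<open>Iterating the recursion bounds \<open>N k\<close> by \<open>N 0\<close> times a product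
  of explicit factors. In the quotients of the weighted products \<open>c\<close> cancels, and they
  tend to 1, so Raabe's test decides.\<close>

lemma summable_moment_recursion:
  fixes N :: "nat \<Rightarrow> real" and \<alpha> \<sigma> c chi q :: real
  assumes \<alpha>: "0 < \<alpha>" and c: "0 < c" and \<sigma>: "1 < \<sigma>" "chi < \<sigma>"
    and nonneg: "\<And>k. 0 \<le> N k"
    and step: "\<And>k m. m = \<sigma> + 2 * \<alpha> * real k \<Longrightarrow> c\<^sup>2 * (1 - chi / m) * N (Suc k) \<le> m * (m - 1) * N k"
    and q: "\<sigma> / \<alpha> + (chi - 1) / (2 * \<alpha>) - 1 / 2 < q"
  shows "summable (\<lambda>k. (c / \<alpha>) ^ (2 * k) / fact (2 * k) * (1 + real k) powr (- q) * N k)"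
proof -
  define M where "M k = \<sigma> + 2 * \<alpha> * real k" for k
  have M: "1 < M k" "chi < M k" for k
    using \<sigma> \<alpha> mult_nonneg_nonneg[of "2 * \<alpha>" "real k"] unfolding M_def by linarith+
  \<comment> \<open>The factor m (m - 1)/(c^2 (1 - chi/m)) of the recursion, at m =
    \<open>M k\<close>; both \<open>1 < M k\<close> and \<open>chi < M k\<close> are used for its
    sign.\<close>
  define \<rho> where "\<rho> k = (M k)\<^sup>2 * (M k - 1) / (c\<^sup>2 * (M k - chi))" for k
  have \<rho>: "0 < \<rho> k" for k using M[of k] c by (simp add: \<rho>_def)
  define R where "R k = (\<Prod>j<k. \<rho> j)" for k
  have R: "0 < R k" for k using \<rho> by (auto simp: R_def intro!: prod_pos)
  have step': "N (Suc k) \<le> \<rho> k * N k" for k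
    using step[OF M_def[of k]] M[of k] c
    by (simp add: \<rho>_def field_simps power2_eq_square)
  have NR: "N k \<le> N 0 * R k" for k
  proof (induction k)
    case (Suc k)
    have "N (Suc k) \<le> \<rho> k * N k" by (rule step')
    also have "\<dots> \<le> \<rho> k * (N 0 * R k)" using Suc.IH \<rho>[of k] by (intro mult_left_mono) auto
    finally show ?case by (simp add: R_def mult_ac)
  qed (simp add: R_def)
  define d where "d k = (c / \<alpha>) ^ (2 * k) / fact (2 * k) * (1 + real k) powr (- q)" for k
  have d: "0 < d k" for k using c \<alpha> by (simp add: d_def)
  \<comment> \<open>Raabe's test asks for positive terms, which the majorant has, while
    \<open>N\<close> is only nonnegative.\<close>
  have "summable (\<lambda>k. d k * R k)"
  proof (rule raabes_test_convergence)
    show "eventually (\<lambda>k. 0 < d k * R k) sequentially" using d R by simp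
    have ratio: "d k * R k / (d (Suc k) * R (Suc k)) =
        \<alpha>\<^sup>2 * (2 * real k + 1) * (2 * real k + 2) * (\<sigma> + 2 * \<alpha> * real k - chi)
      / ((\<sigma> + 2 * \<alpha> * real k)\<^sup>2 * (\<sigma> + 2 * \<alpha> * real k - 1)) * ((real k + 2) / (real k + 1)) powr q" for k
    proof -
      define A where "A = (fact (2 * k) :: real)"
      define C where "C = (c / \<alpha>) ^ (2 * k)"
      have A: "0 < A" by (simp add: A_def)
      have C: "0 < C" using c \<alpha> by (simp add: C_def)
      have e1: "fact (2 * Suc k) = (2 * real k + 1) * (2 * real k + 2) * A"
        by (simp add: A_def algebra_simps)
      have e2: "(c / \<alpha>) ^ (2 * Suc k) = (c / \<alpha>)\<^sup>2 * C"
        by (simp add: C_def power2_eq_square)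
      have e3: "1 + real (Suc k) = real k + 2" by simp
      have "d k / d (Suc k) = (C / A) / ((c / \<alpha>)\<^sup>2 * C / ((2 * real k + 1) * (2 * real k + 2) * A))
          * ((1 + real k) powr (- q) / (real k + 2) powr (- q))"
        unfolding d_def e1 e2 e3 A_def[symmetric] C_def[symmetric] by (simp only: times_divide_times_eq)
      also have "(C / A) / ((c / \<alpha>)\<^sup>2 * C / ((2 * real k + 1) * (2 * real k + 2) * A))
          = (2 * real k + 1) * (2 * real k + 2) * (\<alpha> / c)\<^sup>2"
        using A C c \<alpha> by (simp add: field_simps)
      also have "(1 + real k) powr (- q) / (real k + 2) powr (- q) = ((real k + 2) / (real k + 1)) powr q"
        by (simp add: powr_divide powr_minus field_simps)
      finally have dd: "d k / d (Suc k) = (2 * real k + 1) * (2 * real k + 2) * (\<alpha> / c)\<^sup>2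
          * ((real k + 2) / (real k + 1)) powr q" .
      have "R k / R (Suc k) = 1 / \<rho> k"
      proof -
        have "R (Suc k) = R k * \<rho> k" by (simp add: R_def)
        then show ?thesis using R[of k] by simp
      qed
      with dd have "d k * R k / (d (Suc k) * R (Suc k)) = (2 * real k + 1) * (2 * real k + 2) * (\<alpha> / c)\<^sup>2
          * ((real k + 2) / (real k + 1)) powr q * (1 / \<rho> k)"
        unfolding times_divide_times_eq[symmetric] by simp
      also have "\<dots> = \<alpha>\<^sup>2 * (2 * real k + 1) * (2 * real k + 2) * (M k - chi)
          / ((M k)\<^sup>2 * (M k - 1)) * ((real k + 2) / (real k + 1)) powr q"
        using c by (simp add: \<rho>_def power_divide)
      finally show ?thesis by (simp add: M_def)
    qed
    have "(\<lambda>k. ereal (real k * (d k * R k / (d (Suc k) * R (Suc k)) - 1)))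
        \<longlonglongrightarrow> ereal (q + 3 / 2 - (2 * \<sigma> + chi - 1) / (2 * \<alpha>))"
      unfolding ratio using moment_ratio_limit[OF \<alpha>] by (intro tendsto_intros)
    then have "liminf (\<lambda>k. ereal (real k * (d k * R k / (d (Suc k) * R (Suc k)) - 1)))
        = ereal (q + 3 / 2 - (2 * \<sigma> + chi - 1) / (2 * \<alpha>))"
      by (rule lim_imp_Liminf[rotated]) simp
    \<comment> \<open>The hypothesis \<open>q\<close>, rearranged: it says precisely that Raabe's
      limit exceeds 1.\<close>
    moreover have "1 < q + 3 / 2 - (2 * \<sigma> + chi - 1) / (2 * \<alpha>)"
      using q \<alpha> by (simp add: field_simps)
    ultimately show "1 < liminf (\<lambda>k. ereal (real k * (d k * R k / (d (Suc k) * R (Suc k)) - 1)))"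
      by (simp add: one_ereal_def)
  qed
  then have "summable (\<lambda>k. N 0 * (d k * R k))" by (rule summable_mult)
  then show ?thesis
  proof (rule summable_comparison_test'[where N = 0])
    show "norm ((c / \<alpha>) ^ (2 * k) / fact (2 * k) * (1 + real k) powr (- q) * N k) \<le> N 0 * (d k * R k)" for k
    proof -
      have "d k * N k \<le> d k * (N 0 * R k)" using NR d[of k] by (intro mult_left_mono) auto
      moreover have "0 \<le> d k * N k" using d[of k] nonneg by simp
      ultimately show ?thesis unfolding d_def[symmetric] by (simp add: mult_ac)
    qed
  qed
qed

section \<open>Bounds for the profile\<close>

text \<open>For x < y, x^m \<le> y^(m-1) x, so mass conservation dominates every moment of order at
  least 1 and bounds it by y^m.\<close>

lemma daughter_moment_le:
  assumes coeffs: "frag_coeffs a b" and m: "1 \<le> m" and y: "0 < y"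
  shows "set_integrable lebesgue {0<..<y} (\<lambda>x. x powr m * b x y)" (is ?I)
    and "(LINT x:{0<..<y}|lebesgue. x powr m * b x y) \<le> (1 - delta b m) * y powr m"
proof -
  have b: "\<And>x y. 0 < x \<Longrightarrow> x < y \<Longrightarrow> 0 < b x y"
    "\<And>y. 0 < y \<Longrightarrow> set_integrable lebesgue {0<..<y} (\<lambda>x. x * b x y)"
    "\<And>y. 0 < y \<Longrightarrow> (LINT x:{0<..<y}|lebesgue. x * b x y) = y"
    using coeffs unfolding frag_coeffs_def by blast+
  have le: "x powr m * b x y \<le> y powr (m - 1) * (x * b x y)" if "0 < x" "x < y" for x y
  proof -
    have "x powr m = x powr (m - 1) * x" using that by (simp add: powr_diff)
    also have "\<dots> \<le> y powr (m - 1) * x" using that m by (intro mult_right_mono powr_mono2) auto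
    finally show ?thesis using b(1)[OF that] by (simp add: mult_right_mono mult.assoc[symmetric])
  qed
  have I: "set_integrable lebesgue {0<..<y} (\<lambda>x. x powr m * b x y)" if y: "0 < y" for y
  proof (rule set_integrable_bound)
    show "set_integrable lebesgue {0<..<y} (\<lambda>x. y powr (m - 1) * (x * b x y))"
      using b(2)[OF y] by (intro set_integrable_mult_right)
    have "(\<lambda>x. indicat_real {0<..<y} x *\<^sub>R (x * b x y)) \<in> borel_measurable lebesgue"
      using b(2)[OF y] unfolding set_integrable_def by measurable
    moreover have "(\<lambda>x::real. x powr (m - 1)) \<in> borel_measurable lebesgue"
      by (intro measurable_completion) measurable
    ultimately have "(\<lambda>x. x powr (m - 1) * (indicat_real {0<..<y} x *\<^sub>R (x * b x y))) \<in> borel_measurable lebesgue"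
      by (intro borel_measurable_times)
    moreover have "x powr (m - 1) * (indicat_real {0<..<y} x *\<^sub>R (x * b x y))
        = indicat_real {0<..<y} x *\<^sub>R (x powr m * b x y)" for x
      by (auto simp: indicator_def powr_diff)
    ultimately show "set_borel_measurable lebesgue {0<..<y} (\<lambda>x. x powr m * b x y)"
      by (simp only: set_borel_measurable_def)
    show "AE x in lebesgue. x \<in> {0<..<y} \<longrightarrow> norm (x powr m * b x y) \<le> norm (y powr (m - 1) * (x * b x y))"
      using le b(1) by (auto intro!: AE_I2 simp: abs_mult less_imp_le)
  qed
  show ?I using I[OF y] .
  have "(LINT x:{0<..<y}|lebesgue. x powr m * b x y) \<le> y powr m" if y: "0 < y" for y
  proof -
    have "(LINT x:{0<..<y}|lebesgue. x powr m * b x y)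
        \<le> (LINT x:{0<..<y}|lebesgue. y powr (m - 1) * (x * b x y))"
      using le by (intro set_integral_mono I[OF y] set_integrable_mult_right b(2)[OF y]) auto
    also have "\<dots> = y powr m" using b(3)[OF y] y by (simp add: powr_diff)
    finally show ?thesis .
  qed
  \<comment> \<open>The real-valued infimum in \<open>delta\<close> is a lower bound of its values
    only once these are known to be bounded below, here by 0.\<close>
  then have "bdd_below ((\<lambda>y. 1 - 1 / y powr m * (LINT x:{0<..<y}|lebesgue. x powr m * b x y)) ` {0<..})"
    by (intro bdd_belowI[of _ 0]) (auto simp: field_simps)
  then have "delta b m \<le> 1 - 1 / y powr m * (LINT x:{0<..<y}|lebesgue. x powr m * b x y)"
    unfolding delta_def using y by (intro cINF_lower) auto
  then show "(LINT x:{0<..<y}|lebesgue. x powr m * b x y) \<le> (1 - delta b m) * y powr m"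
    using y by (simp add: field_simps)
qed

text \<open>Put y = z x. Since x \<ge> 1 and \<alpha> \<ge> 1, y^\<alpha> - x^\<alpha> = x^\<alpha>
  (z^\<alpha> - 1) \<ge> z - 1, so the quotient of the two sides without K is at most z^r exp(-\<nu>
  (z - 1)), which is bounded.\<close>

lemma powr_exp_decay:
  fixes r \<nu> \<alpha> :: real
  assumes r: "0 < r" and \<nu>: "0 < \<nu>" and \<alpha>: "1 \<le> \<alpha>"
  shows "\<exists>K>0. \<forall>x\<ge>1. \<forall>y\<ge>x. y powr r * exp (- (\<nu> * y powr \<alpha>)) \<le> K * (x powr r * exp (- (\<nu> * x powr \<alpha>)))"
proof (intro exI conjI allI impI)
  \<comment> \<open>The maximum of z^r exp(-\<nu> (z - 1)) over z > 0, attained at z =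
    r/\<nu>.\<close>
  define K where "K = exp (\<nu> - r - r * ln (\<nu> / r))"
  show "0 < K" by (simp add: K_def)
  fix x y :: real assume x: "1 \<le> x" and y: "x \<le> y"
  define z where "z = y / x"
  have z: "1 \<le> z" "y = z * x" using x y by (simp_all add: z_def)
  have "ln (\<nu> / r * z) \<le> \<nu> / r * z - 1" using z r \<nu> by (intro ln_le_minus_one) auto
  then have "r * (ln (\<nu> / r) + ln z) \<le> r * (\<nu> / r * z - 1)"
    using z r \<nu> by (subst (asm) ln_mult) auto
  then have lnz: "r * ln z \<le> \<nu> * z - r - r * ln (\<nu> / r)"
    using r by (simp add: algebra_simps)
  have "1 \<le> x powr \<alpha>" using x \<alpha> by (simp add: ge_one_powr_ge_zero)
  moreover have "z powr 1 \<le> z powr \<alpha>" using z \<alpha> by (intro powr_mono) auto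
  ultimately have "1 * (z - 1) \<le> x powr \<alpha> * (z powr \<alpha> - 1)" using z by (intro mult_mono) auto
  then have "z - 1 + x powr \<alpha> \<le> y powr \<alpha>" using z x by (simp add: powr_mult algebra_simps)
  then have "\<nu> * (z - 1 + x powr \<alpha>) \<le> \<nu> * y powr \<alpha>" using \<nu> by (intro mult_left_mono) auto
  then have "r * ln z - \<nu> * y powr \<alpha> \<le> \<nu> - r - r * ln (\<nu> / r) - \<nu> * x powr \<alpha>"
    using lnz by (simp add: algebra_simps)
  then have "exp (r * ln z - \<nu> * y powr \<alpha>) \<le> K * exp (- (\<nu> * x powr \<alpha>))"
    by (simp add: K_def flip: exp_add)
  then have "x powr r * exp (r * ln z - \<nu> * y powr \<alpha>) \<le> x powr r * (K * exp (- (\<nu> * x powr \<alpha>)))"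
    by (rule mult_left_mono) simp
  moreover have "exp (r * ln z - \<nu> * y powr \<alpha>) = z powr r * exp (- (\<nu> * y powr \<alpha>))"
    using z by (simp add: powr_def exp_diff exp_minus divide_inverse)
  ultimately show "y powr r * exp (- (\<nu> * y powr \<alpha>)) \<le> K * (x powr r * exp (- (\<nu> * x powr \<alpha>)))"
    using z x by (simp add: powr_mult mult_ac)
qed

text \<open>The series is x^s times the damped cosh series at t = \<nu> x^\<alpha>. For x \<ge> 1, 1
  + t/2 is at most a constant times x^\<alpha>, so the damping costs x^(-\<alpha> q), and cosh t
  \<ge> exp(t)/2.\<close>

lemma power_series_ge_powr_exp:
  fixes x \<nu> \<alpha> q s :: real
  assumes \<nu>: "0 \<le> \<nu>" and \<alpha>: "0 \<le> \<alpha>" and q: "0 \<le> q" and x: "1 \<le> x"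
  defines "w \<equiv> \<lambda>k. \<nu> ^ (2 * k) / fact (2 * k) * (1 + real k) powr (- q) * x powr (s + 2 * \<alpha> * real k)"
  shows "summable w"
    and "(1 + \<nu> / 2) powr (- q) / 2 * (x powr (s - \<alpha> * q) * exp (\<nu> * x powr \<alpha>)) \<le> suminf w"
proof -
  define t where "t = \<nu> * x powr \<alpha>"
  have t: "0 \<le> t" using \<nu> by (simp add: t_def)
  define v where "v k = t ^ (2 * k) / fact (2 * k) * (1 + real k) powr (- q)" for k
  have wv: "w = (\<lambda>k. x powr s * v k)"
  proof
    fix k
    have "x powr (2 * \<alpha> * real k) = (x powr \<alpha>) ^ (2 * k)"
      using x by (simp add: powr_powr mult_ac flip: powr_realpow)
    then show "w k = x powr s * v k"
      by (simp add: w_def v_def t_def powr_add power_mult_distrib)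
  qed
  have v: "summable v" "(1 + t / 2) powr (- q) * cosh t \<le> suminf v"
    using cosh_series_powr_weight_ge[OF t q] by (simp_all add: v_def[abs_def])
  show "summable w" unfolding wv using v(1) by (rule summable_mult)
  have X: "1 \<le> x powr \<alpha>" using x \<alpha> by (simp add: ge_one_powr_ge_zero)
  have "1 + t / 2 \<le> (1 + \<nu> / 2) * x powr \<alpha>" using X by (simp add: t_def algebra_simps)
  then have "((1 + \<nu> / 2) * x powr \<alpha>) powr (- q) \<le> (1 + t / 2) powr (- q)"
    using t q by (intro powr_mono2') auto
  moreover have "exp t / 2 \<le> cosh t" by (simp add: cosh_def)
  ultimately have "((1 + \<nu> / 2) * x powr \<alpha>) powr (- q) * (exp t / 2) \<le> (1 + t / 2) powr (- q) * cosh t"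
    by (intro mult_mono) auto
  also note v(2)
  finally have "x powr s * (((1 + \<nu> / 2) * x powr \<alpha>) powr (- q) * (exp t / 2)) \<le> x powr s * suminf v"
    by (rule mult_left_mono) simp
  also have "\<dots> = suminf w" unfolding wv using v(1) by (rule suminf_mult[symmetric])
  also have "((1 + \<nu> / 2) * x powr \<alpha>) powr (- q) = (1 + \<nu> / 2) powr (- q) * x powr (- (\<alpha> * q))"
    using \<nu> by (simp add: powr_mult powr_powr)
  finally show "(1 + \<nu> / 2) powr (- q) / 2 * (x powr (s - \<alpha> * q) * exp (\<nu> * x powr \<alpha>)) \<le> suminf w"
    using x by (simp add: t_def mult_ac powr_minus powr_diff field_simps)
qed

theorem proposition4p1:
  fixes a :: "real \<Rightarrow> real" and b :: "real \<Rightarrow> real \<Rightarrow> real" and f :: "real \<Rightarrow> real"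
    and \<gamma> \<aa> \<alpha> chi m\<^sub>0 \<mu> :: real
  assumes coeffs: "frag_coeffs a b"
    and profile: "stationary_profile a b f"
    and \<gamma>: "0 \<le> \<gamma>" and \<aa>: "0 < \<aa>"
    and a_power: "\<And>x. 0 < x \<Longrightarrow> a x = \<aa> * x powr \<gamma>"
    and \<alpha>: "\<alpha> = (\<gamma> + 2) / 2"
    and chi_nonneg: "0 \<le> chi" and m\<^sub>0: "1 \<le> m\<^sub>0"
    and delta_bounds: "\<And>m. m\<^sub>0 \<le> m \<Longrightarrow> 1 < m \<Longrightarrow> 1 - chi / m \<le> delta b m \<and> delta b m \<le> 1"
    and \<mu>: "(\<alpha> + chi - 1) / 2 < \<mu>"
  shows "\<exists>\<kappa>>0. \<forall>x\<ge>1.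
           f 1 * x powr (- \<gamma> / 4) * exp (- sqrt \<aa> * x powr \<alpha> / \<alpha>) \<le> f x \<and>
           f x \<le> \<kappa> * x powr (1 + \<alpha> + \<mu>) * exp (- sqrt \<aa> * x powr \<alpha> / \<alpha>)"
proof -

  \<comment> \<open>Regularity and integrability of the profile, loss term and gain term\<close>
  define f1 where "f1 = deriv f"
  define f2 where "f2 = deriv (deriv f)"
  define c where "c = sqrt \<aa>"
  define u where "u x = a x * f x" for x
  define g where "g x = (LINT y:{x<..}|lebesgue. u y * b x y)" for x
  have c: "0 < c" "c\<^sup>2 = \<aa>" using \<aa> by (simp_all add: c_def)
  have \<alpha>1: "1 \<le> \<alpha>" using \<alpha> \<gamma> by simp
  have f_nonneg: "0 \<le> f x" if "0 \<le> x" for x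
    using profile that by (simp add: stationary_profile_def)
  have smooth: "(deriv ^^ n) f field_differentiable (at x)" if "0 < x" for n x
    using profile that by (simp add: stationary_profile_def smooth_pos_def)
  have d1: "(f has_real_derivative f1 x) (at x)" if "0 < x" for x
    using smooth[OF that, of 0] by (simp add: f1_def DERIV_deriv_iff_field_differentiable)
  have d2: "(f1 has_real_derivative f2 x) (at x)" if "0 < x" for x
    using smooth[OF that, of 1] by (simp add: f1_def f2_def DERIV_deriv_iff_field_differentiable)
  have f_cont: "continuous_on {0<..} f"
    using d1 by (auto intro!: continuous_at_imp_continuous_on DERIV_isCont)
  have f2_cont: "continuous_on {0<..} f2"
    using smooth[of _ 2] unfolding f2_def
    by (auto intro!: continuous_at_imp_continuous_on field_differentiable_imp_continuous_at
        simp: numeral_2_eq_2)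
  have u_eq: "u x = \<aa> * x powr \<gamma> * f x" if "0 < x" for x
    using a_power[OF that] by (simp add: u_def)
  have "continuous_on {0<..} (\<lambda>x. \<aa> * x powr \<gamma> * f x)"
    by (auto intro!: continuous_intros f_cont)
  then have u_cont: "continuous_on {0<..} u"
    by (rule continuous_on_eq) (simp add: u_eq)
  have u_nonneg: "0 \<le> u x" if "0 < x" for x
    using that u_eq f_nonneg \<aa> by simp
  have f_0: "(f \<longlongrightarrow> 0) (at_right 0)"
  proof -
    have "continuous_on {0..} f" "f 0 = 0" using profile by (auto simp: stationary_profile_def)
    then have "(f \<longlongrightarrow> 0) (at 0 within {0..})"
      unfolding continuous_on_def by force
    then show ?thesis by (rule tendsto_within_subset) auto
  qed
  have f_int: "set_integrable lborel {0<..} (\<lambda>x. x powr m * f x)" if "- 1 < m" for m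
    using profile that
    by (subst set_integrable_lebesgue_iff_lborel[symmetric])
       (auto simp: stationary_profile_def X_space_def intro!: continuous_intros f_cont)
  have u_int: "set_integrable lborel {0<..} (\<lambda>x. x powr m * u x)" if "- 1 < m" for m
    using profile that unfolding u_def[symmetric]
    by (subst set_integrable_lebesgue_iff_lborel[symmetric])
       (auto simp: stationary_profile_def X_space_def u_def[abs_def]
         intro!: continuous_intros u_cont[unfolded u_def[abs_def]])
  have f2_int: "set_integrable lborel {0<..} (\<lambda>x. x powr m * f2 x)" if "1 \<le> m" for m
    using profile that
    by (subst set_integrable_lebesgue_iff_lborel[symmetric])
       (auto simp: stationary_profile_def X_space_def f2_def[symmetric] intro!: continuous_intros f2_cont)
  have b_pos: "0 < b x y" if "0 < x" "x < y" for x y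
    using coeffs that by (simp add: frag_coeffs_def)
  have b_meas: "(\<lambda>(x, y). b x y) \<in> borel_measurable (lebesgue_on {(x, y). 0 < x \<and> x < y})"
    using coeffs by (simp add: frag_coeffs_def)
  have g_int: "set_integrable lebesgue {x<..} (\<lambda>y. u y * b x y)"
    and f2_eq: "f2 x = u x - g x" if "0 < x" for x
    using profile that
    by (auto simp: stationary_profile_def u_def g_def f2_def mult_ac)
  have g_nonneg: "0 \<le> g x" if "0 < x" for x
    unfolding g_def set_lebesgue_integral_def using that u_nonneg b_pos
    by (intro Bochner_Integration.integral_nonneg) (auto simp: indicator_def less_imp_le)
  have super: "f2 x \<le> u x" if "0 < x" for x using f2_eq[OF that] g_nonneg[OF that] by simp

  \<comment> \<open>The lower bound\<close>
  have lower: "f 1 * x powr (- \<gamma> / 4) * exp (- c * x powr \<alpha> / \<alpha>) \<le> f x" if "1 \<le> x" for x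
    using super u_eq c(2) by (intro WKB_lower_bound[OF d1 d2 f_nonneg _ c(1) \<gamma> \<alpha> that]) auto

  \<comment> \<open>The recursive inequality for the moments\<close>
  define M where "M m = (LBINT x:{0<..}. x powr m * f x)" for m
  have M_nonneg: "0 \<le> M m" for m
    unfolding M_def set_lebesgue_integral_def using f_nonneg
    by (intro Bochner_Integration.integral_nonneg) (auto simp: indicator_def)
  \<comment> \<open>The equation f'' = u - g is integrated against x^m. The gain term takes at most
    the fraction 1 - \<delta>_m \<le> chi/m of the moment of \<open>u\<close>.\<close>
  have recursion: "\<aa> * (1 - chi / m) * M (m + \<gamma>) \<le> m * (m - 1) * M (m - 2)"
    if m: "m\<^sub>0 \<le> m" "2 \<le> m" for m
  proof -
    have mg: "set_integrable lborel {0<..} (\<lambda>x. x powr m * u x - x powr m * f2 x)"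
      using m by (intro set_integral_diff u_int f2_int) auto
    have eq: "x powr m * g x = x powr m * u x - x powr m * f2 x" if "x \<in> {0<..}" for x
      using f2_eq[of x] that by (simp add: right_diff_distrib)
    have gi: "set_integrable lborel {0<..} (\<lambda>x. x powr m * g x)"
      using mg by (subst set_integrable_cong[OF refl refl eq])
    have "(LBINT x:{0<..}. x powr m * g x) \<le> (chi / m) * (LBINT x:{0<..}. x powr m * u x)"
    proof (rule gain_moment_le[OF b_meas _ u_cont u_nonneg _ _ _ _ gi])
      show "(LINT x:{0<..<y}|lebesgue. x powr m * b x y) \<le> chi / m * y powr m" if "0 < y" for y
      proof -
        have "(LINT x:{0<..<y}|lebesgue. x powr m * b x y) \<le> (1 - delta b m) * y powr m"
          using daughter_moment_le(2)[OF coeffs _ that] m by simp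
        also have "\<dots> \<le> chi / m * y powr m"
          using delta_bounds[of m] m by (intro mult_right_mono) auto
        finally show ?thesis .
      qed
    qed (use m chi_nonneg b_pos g_int g_def u_int daughter_moment_le(1)[OF coeffs] in \<open>auto simp: less_imp_le\<close>)
    moreover have "(LBINT x:{0<..}. x powr m * g x)
        = (LBINT x:{0<..}. x powr m * u x) - (LBINT x:{0<..}. x powr m * f2 x)"
    proof -
      have "(LBINT x:{0<..}. x powr m * g x) = (LBINT x:{0<..}. x powr m * u x - x powr m * f2 x)"
        using eq by (intro set_lebesgue_integral_cong) auto
      also have "\<dots> = (LBINT x:{0<..}. x powr m * u x) - (LBINT x:{0<..}. x powr m * f2 x)"
        using m by (intro set_integral_diff u_int f2_int) auto
      finally show ?thesis .
    qed
    moreover have "(LBINT x:{0<..}. x powr m * f2 x) = m * (m - 1) * M (m - 2)"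
      unfolding M_def
      by (rule second_derivative_moment[OF d1 d2 f2_cont f_0 f_int f2_int m(2)])
    moreover have "(LBINT x:{0<..}. x powr m * u x) = \<aa> * M (m + \<gamma>)"
    proof -
      have "(LBINT x:{0<..}. x powr m * u x) = (LBINT x:{0<..}. \<aa> * (x powr (m + \<gamma>) * f x))"
        by (intro set_lebesgue_integral_cong) (auto simp: u_eq powr_add)
      then show ?thesis by (simp add: M_def)
    qed
    ultimately show ?thesis by (simp add: algebra_simps)
  qed

  \<comment> \<open>Choice of the exponents and summability of the weighted moments\<close>
  define p where "p = \<mu> + 2 - \<alpha>"
  \<comment> \<open>The order at which the recursion starts: at least \<open>m\<^sub>0\<close> and 2
    for \<open>recursion\<close>, above chi for positive factors, and at least 2 - p so that
    \<open>q\<close> is nonnegative.\<close>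
  define \<sigma> where "\<sigma> = max (max m\<^sub>0 2) (max (chi + 1) (2 - p))"
  define s where "s = \<sigma> - 2"
  \<comment> \<open>This makes \<open>s - \<alpha> * q\<close> equal to \<open>- p\<close>. In turn
    \<open>p\<close> and \<open>r\<close> satisfy r - p = \<gamma> + 1, the exponent of y in y
    a(y).\<close>
  define q where "q = (p + s) / \<alpha>"
  define r where "r = 1 + \<alpha> + \<mu>"
  have \<sigma>: "m\<^sub>0 \<le> \<sigma>" "2 \<le> \<sigma>" "chi < \<sigma>" "0 \<le> p + s"
    by (auto simp: \<sigma>_def s_def)
  have q: "0 \<le> q" using \<sigma> \<alpha>1 by (simp add: q_def)
  have \<alpha>q: "s - \<alpha> * q = - p" using \<alpha>1 by (simp add: q_def)
  have r: "0 < r" using \<mu> chi_nonneg \<alpha>1 by (simp add: r_def)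
  define d where "d k = (c / \<alpha>) ^ (2 * k) / fact (2 * k) * (1 + real k) powr (- q)" for k
  have d: "0 < d k" for k using c \<alpha>1 by (simp add: d_def)
  define N where "N k = M (s + 2 * \<alpha> * real k)" for k
  have summable: "summable (\<lambda>k. d k * N k)"
    unfolding d_def
  proof (rule summable_moment_recursion[where \<sigma> = \<sigma> and chi = chi and N = N])
    \<comment> \<open>Multiplied by \<alpha>, with p + s = \<mu> - \<alpha> + \<sigma>, this is
      exactly the hypothesis on \<mu>.\<close>
    show "\<sigma> / \<alpha> + (chi - 1) / (2 * \<alpha>) - 1 / 2 < q"
    proof -
      have "\<sigma> / \<alpha> + (chi - 1) / (2 * \<alpha>) - 1 / 2 = (\<sigma> + (chi - 1) / 2 - \<alpha> / 2) / \<alpha>"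
        using \<alpha>1 by (simp add: field_simps)
      also have "\<dots> < q"
        unfolding q_def using \<mu> \<alpha>1 by (intro divide_strict_right_mono) (auto simp: p_def s_def field_simps)
      finally show ?thesis .
    qed
    fix k m assume m: "m = \<sigma> + 2 * \<alpha> * real k"
    have "0 \<le> 2 * \<alpha> * real k" using \<alpha>1 by simp
    then have "m\<^sub>0 \<le> m" "2 \<le> m" using \<sigma> m by linarith+
    from recursion[OF this] have "c\<^sup>2 * (1 - chi / m) * M (m + \<gamma>) \<le> m * (m - 1) * M (m - 2)"
      unfolding c(2) .
    \<comment> \<open>Since 2 \<alpha> = \<gamma> + 2, the two moments in the recursion are
      neighbours in the sequence \<open>N\<close>.\<close>
    moreover have "m + \<gamma> = s + 2 * \<alpha> * real (Suc k)" "m - 2 = s + 2 * \<alpha> * real k"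
      unfolding m s_def using \<alpha> by (simp_all add: algebra_simps)
    ultimately show "c\<^sup>2 * (1 - chi / m) * N (Suc k) \<le> m * (m - 1) * N k"
      by (simp only: N_def)
  qed (use \<alpha>1 c \<sigma> M_nonneg in \<open>auto simp: N_def\<close>)

  \<comment> \<open>The pointwise upper bound\<close>
  obtain K where K: "0 < K" and decay: "\<And>x y. 1 \<le> x \<Longrightarrow> x \<le> y \<Longrightarrow>
      y powr r * exp (- (c / \<alpha> * y powr \<alpha>)) \<le> K * (x powr r * exp (- (c / \<alpha> * x powr \<alpha>)))"
    using powr_exp_decay[OF r _ \<alpha>1, of "c / \<alpha>"] c \<alpha>1 by auto
  define L where "L = (1 + c / \<alpha> / 2) powr (- q) / 2"
  have L: "0 < L"
  proof -
    have "0 < c / \<alpha>" using c \<alpha>1 by simp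
    then show ?thesis by (simp add: L_def)
  qed
  define \<Sigma> where "\<Sigma> = (\<Sum>k. d k * N k)"
  have \<Sigma>: "0 \<le> \<Sigma>"
    unfolding \<Sigma>_def using d M_nonneg by (intro suminf_nonneg summable) (auto simp: N_def less_imp_le)
  have upper: "f x \<le> \<aa> * K / L * (x powr r * exp (- (c / \<alpha> * x powr \<alpha>))) * \<Sigma>" if x: "1 \<le> x" for x
  proof -
    define E where "E = \<aa> * K / L * (x powr r * exp (- (c / \<alpha> * x powr \<alpha>)))"
    have E: "0 \<le> E" using \<aa> K L by (simp add: E_def)
    \<comment> \<open>The k-th summand has integral \<open>d k * N k\<close> over the whole
      half-line, so the sum \<Sigma> does not depend on x; all dependence on x is in
      \<open>E\<close>.\<close>
    define h where "h k y = d k * (indicator {0<..} y * (y powr (s + 2 * \<alpha> * real k) * f y))" for k y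
    have hi: "set_integrable lborel {0<..} (\<lambda>y. y powr (s + 2 * \<alpha> * real k) * f y)" for k
    proof (rule f_int)
      have "0 \<le> 2 * \<alpha> * real k" using \<alpha>1 by simp
      then show "- 1 < s + 2 * \<alpha> * real k" using \<sigma>(2) by (simp add: s_def)
    qed
    have h_nonneg: "0 \<le> h k y" for k y
      using d[of k] f_nonneg[of y] by (simp add: h_def indicator_def)
    have bound: "ennreal (indicator {x<..} y * (y powr 1 * u y)) \<le> ennreal E * (\<Sum>k. ennreal (h k y))" for y
    proof (cases "x < y")
      case True
      then have y: "1 \<le> y" "0 < y" using x by auto
      define w where "w k = d k * y powr (s + 2 * \<alpha> * real k)" for k
      have "0 \<le> c / \<alpha>" "0 \<le> \<alpha>" using c \<alpha>1 by simp_all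
      note series = power_series_ge_powr_exp[OF this q y(1), of s, folded L_def, folded d_def, folded w_def]
      have hw: "h k y = w k * f y" for k using y by (simp add: h_def w_def)
      have "(\<lambda>k. h k y) sums (suminf w * f y)"
        unfolding hw using series(1) by (intro sums_mult2 summable_sums)
      then have 1: "(\<Sum>k. ennreal (h k y)) = ennreal (suminf w * f y)"
        by (intro suminf_ennreal_eq h_nonneg)
      \<comment> \<open>Inserting exp(-c y^\<alpha>/\<alpha>) exp(c y^\<alpha>/\<alpha>) splits the
        weight: the decaying factor is replaced by its bound at x, the growing one by the
        series.\<close>
      have "y powr 1 * u y = \<aa> * f y * (y powr r * y powr (- p))"
        using y \<alpha> by (simp add: u_eq r_def p_def flip: powr_add) (simp add: powr_add field_simps)
      also have "\<dots> = \<aa> * f y * ((y powr r * exp (- (c / \<alpha> * y powr \<alpha>)))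
          * (y powr (s - \<alpha> * q) * exp (c / \<alpha> * y powr \<alpha>)))"
        unfolding \<alpha>q by (simp add: exp_minus field_simps)
      also have "\<dots> \<le> \<aa> * f y * ((K * (x powr r * exp (- (c / \<alpha> * x powr \<alpha>)))) * (suminf w / L))"
      proof (rule mult_left_mono[OF mult_mono])
        show "y powr r * exp (- (c / \<alpha> * y powr \<alpha>)) \<le> K * (x powr r * exp (- (c / \<alpha> * x powr \<alpha>)))"
          using decay[OF x] True by simp
        show "y powr (s - \<alpha> * q) * exp (c / \<alpha> * y powr \<alpha>) \<le> suminf w / L"
          using series(2) L by (simp add: field_simps)
      qed (use K \<aa> f_nonneg[of y] y in auto)
      also have "\<dots> = E * (suminf w * f y)" by (simp add: E_def)
      finally have "y powr 1 * u y \<le> E * (suminf w * f y)" .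
      then have "ennreal (y powr 1 * u y) \<le> ennreal (E * (suminf w * f y))" by (rule ennreal_leI)
      also have "\<dots> = ennreal E * (\<Sum>k. ennreal (h k y))" unfolding 1 using E by (rule ennreal_mult')
      finally show ?thesis using True by simp
    qed simp
    have ui: "set_integrable lborel {x<..} (\<lambda>y. y powr 1 * u y)"
      using x by (intro set_integrable_subset[OF u_int[of 1]]) auto
    have "f x = (LBINT y:{x<..}. (y - x) * f2 y)"
      using x by (intro profile_eq_integral(2)[OF d1 d2 f2_cont f_0 f_int f2_int]) auto
    also have "\<dots> \<le> (LBINT y:{x<..}. y powr 1 * u y)"
    proof (rule set_integral_mono[OF _ ui])
      show "set_integrable lborel {x<..} (\<lambda>y. (y - x) * f2 y)"
        using x by (intro profile_eq_integral(1)[OF d1 d2 f2_cont f_0 f_int f2_int]) auto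
      show "(y - x) * f2 y \<le> y powr 1 * u y" if "y \<in> {x<..}" for y
      proof -
        have "(y - x) * f2 y \<le> (y - x) * u y" using that x super[of y] by (intro mult_left_mono) auto
        also have "\<dots> \<le> y powr 1 * u y" using that x u_nonneg[of y] by (intro mult_right_mono) auto
        finally show ?thesis .
      qed
    qed
    \<comment> \<open>In \<open>ennreal\<close>, sum and integral interchange by nonnegativity;
      \<open>summable\<close> then shows that the value is finite.\<close>
    finally have "ennreal (f x) \<le> ennreal (LBINT y:{x<..}. y powr 1 * u y)" by (rule ennreal_leI)
    also have "\<dots> = (\<integral>\<^sup>+y. ennreal (indicator {x<..} y * (y powr 1 * u y)) \<partial>lborel)"
      using ui x u_nonneg unfolding set_integrable_def set_lebesgue_integral_def
      by (subst nn_integral_eq_integral) (auto simp: indicator_def)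
    also have "\<dots> \<le> (\<integral>\<^sup>+y. ennreal E * (\<Sum>k. ennreal (h k y)) \<partial>lborel)"
      using bound by (rule nn_integral_mono)
    also have "\<dots> = ennreal E * (\<Sum>k. \<integral>\<^sup>+y. ennreal (h k y) \<partial>lborel)"
    proof -
      have "(\<lambda>y. indicator {0<..} y * (y powr (s + 2 * \<alpha> * real k) * f y)) \<in> borel_measurable lborel" for k
        using borel_measurable_integrable[OF hi[of k, unfolded set_integrable_def]] by simp
      from borel_measurable_times[OF borel_measurable_const this]
      have "h k \<in> borel_measurable lborel" for k by (simp only: h_def[abs_def])
      then have "(\<lambda>y. ennreal (h k y)) \<in> borel_measurable lborel" for k
        by (rule measurable_compose[OF _ measurable_ennreal])
      then show ?thesis by (simp add: nn_integral_cmult nn_integral_suminf)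
    qed
    also have "(\<lambda>k. \<integral>\<^sup>+y. ennreal (h k y) \<partial>lborel) = (\<lambda>k. ennreal (d k * N k))"
    proof
      fix k
      show "(\<integral>\<^sup>+y. ennreal (h k y) \<partial>lborel) = ennreal (d k * N k)"
        using hi[of k] h_nonneg unfolding h_def N_def M_def set_integrable_def set_lebesgue_integral_def
        by (subst nn_integral_eq_integral) auto
    qed
    also have "(\<Sum>k. ennreal (d k * N k)) = ennreal \<Sigma>"
      unfolding \<Sigma>_def using d M_nonneg
      by (intro suminf_ennreal_eq summable_sums[OF summable]) (auto simp: N_def less_imp_le)
    also have "ennreal E * ennreal \<Sigma> = ennreal (E * \<Sigma>)" using E by (simp add: ennreal_mult')
    finally show ?thesis using E \<Sigma> unfolding E_def[symmetric] by simp
  qed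
  show ?thesis
  \<comment> \<open>The summand 1 makes the constant positive, as \<Sigma> is only known to be
    nonnegative.\<close>
  proof (intro exI[of _ "\<aa> * K / L * \<Sigma> + 1"] conjI allI impI)
    show "0 < \<aa> * K / L * \<Sigma> + 1" using \<aa> K L \<Sigma> by (intro add_nonneg_pos) auto
    fix x :: real assume x: "1 \<le> x"
    show "f 1 * x powr (- \<gamma> / 4) * exp (- sqrt \<aa> * x powr \<alpha> / \<alpha>) \<le> f x"
      using lower[OF x] by (simp add: c_def)
    have "f x \<le> \<aa> * K / L * \<Sigma> * (x powr r * exp (- (c / \<alpha> * x powr \<alpha>)))"
      using upper[OF x] by (simp add: mult_ac)
    also have "\<dots> \<le> (\<aa> * K / L * \<Sigma> + 1) * (x powr r * exp (- (c / \<alpha> * x powr \<alpha>)))"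
      by (intro mult_right_mono) auto
    finally show "f x \<le> (\<aa> * K / L * \<Sigma> + 1) * x powr (1 + \<alpha> + \<mu>) * exp (- sqrt \<aa> * x powr \<alpha> / \<alpha>)"
      by (simp add: r_def c_def mult.assoc)
  qed
qed

end
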